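(* Let $n \geq 2$ be an integer. Then there does not exist a simple graph on $n$ vertices whose Laplacian spectrum is $\{0,1,2,\ldots,n-1\}$ (i.e. whose Laplacian matrix has eigenvalues exactly $0,1,\ldots,n-1$, each with multiplicity one).
   Context: Graphs are finite, simple and unweighted. The Laplacian matrix $L(G)$ of a graph $G$ is indexed by $V(G)$, with $[L(G)]_{v,v}=d_G(v)$ (the degree of $v$), $[L(G)]_{v,w}=-1$ if $\{v,w\}\in E(G)$, and $[L(G)]_{v,w}=0$ otherwise. The Laplacian spectrum of $G$ is the multiset of eigenvalues of $L(G)$. *)

theory Defs
  imports "Graph_Theory.Pair_Digraph" "Jordan_Normal_Form.Char_Poly"
begin

text \<open>
  A finite simple graph is a \<^locale>\<open>pair_graph\<close>: a finite loopless symmetric set of pairs, where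
  an edge \<open>{v, w}\<close> is represented by the two pairs \<open>(v, w)\<close> and \<open>(w, v)\<close>.  Hence the degree of \<open>v\<close>
  is the number of pairs that start at \<open>v\<close>.
\<close>

definition laplacian :: "'a pair_pre_digraph \<Rightarrow> 'a \<Rightarrow> 'a \<Rightarrow> real" where
  "laplacian G v w =
     (if v = w then real (out_degree (with_proj G) v)
      else if (v, w) \<in> parcs G then - 1
      else 0)"

definition laplacian_mat :: "'a pair_pre_digraph \<Rightarrow> 'a list \<Rightarrow> real mat" where
  "laplacian_mat G vs = mat (length vs) (length vs) (\<lambda>(i, j). laplacian G (vs ! i) (vs ! j))"

text \<open>
  Eigenvalues are counted with algebraic multiplicity.  The matrix is real symmetric, so all its
  eigenvalues are real and nothing is lost by taking roots in \<^typ>\<open>real\<close>.  The enumeration of the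
  vertices is immaterial by \<open>laplacian_spectrum_eq\<close> below.
\<close>

definition laplacian_spectrum :: "'a pair_pre_digraph \<Rightarrow> real multiset" where
  "laplacian_spectrum G =
     proots (char_poly (laplacian_mat G (SOME vs. distinct vs \<and> set vs = pverts G)))"

lemma sum_nth_delta:
  fixes f :: "'a \<Rightarrow> real"
  assumes "distinct ws" "x \<in> set ws"
  shows "(\<Sum>k = 0..<length ws. of_bool (x = ws ! k) * f (ws ! k)) = f x"
proof -
  have "(\<Sum>k = 0..<length ws. of_bool (x = ws ! k) * f (ws ! k)) =
        (\<Sum>y \<in> set ws. of_bool (x = y) * f y)"
    by (rule sum.reindex_bij_betw[of "(!) ws" "{0..<length ws}" "set ws" "\<lambda>y. of_bool (x = y) * f y"])
       (use assms bij_betw_nth[of ws "{0..<length ws}" "set ws"] in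
         \<open>auto simp: atLeast0LessThan\<close>)
  also have "\<dots> = (\<Sum>y \<in> set ws. if x = y then f y else 0)"
    by (rule sum.cong) auto
  also have "\<dots> = f x"
    using assms by (simp add: sum.delta)
  finally show ?thesis .
qed

lemma char_poly_laplacian_mat_cong:
  assumes "distinct vs" "distinct ws" "set vs = set ws"
  shows "char_poly (laplacian_mat G vs) = char_poly (laplacian_mat G ws)"
proof (rule char_poly_similar)
  define n where "n = length vs"
  have n: "length vs = n" "length ws = n"
    using assms distinct_card[of vs] distinct_card[of ws] by (auto simp: n_def)
  define P where "P = (\<lambda>xs ys :: 'a list. mat n n (\<lambda>(i, j). of_bool (xs ! i = ys ! j) :: real))"
  have P: "P xs ys \<in> carrier_mat n n" for xs ys
    by (simp add: P_def)
  have L: "laplacian_mat G vs \<in> carrier_mat n n" "laplacian_mat G ws \<in> carrier_mat n n"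
    by (simp_all add: laplacian_mat_def n)
  have in_ws: "vs ! i \<in> set ws" and in_vs: "ws ! i \<in> set vs" if "i < n" for i
    using that assms n nth_mem by metis+
  have one: "P xs ys * P ys xs = 1\<^sub>m n"
    if "distinct xs" "distinct ys" "set xs = set ys" "length xs = n" "length ys = n" for xs ys
  proof (rule eq_matI)
    fix i j assume "i < dim_row (1\<^sub>m n :: real mat)" "j < dim_col (1\<^sub>m n :: real mat)"
    then have ij: "i < n" "j < n" by auto
    have "(P xs ys * P ys xs) $$ (i, j) =
          (\<Sum>k = 0..<length ys. of_bool (xs ! i = ys ! k) * of_bool (ys ! k = xs ! j))"
      using ij that by (simp add: P_def scalar_prod_def)
    also have "\<dots> = of_bool (xs ! i = xs ! j)"
      using sum_nth_delta[of ys "xs ! i" "\<lambda>y. of_bool (y = xs ! j)"] that ij nth_mem[of i xs] by simp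
    also have "\<dots> = (1\<^sub>m n :: real mat) $$ (i, j)"
      using ij that by (simp add: nth_eq_iff_index_eq)
    finally show "(P xs ys * P ys xs) $$ (i, j) = (1\<^sub>m n :: real mat) $$ (i, j)" .
  qed (auto simp: P_def)
  have "laplacian_mat G vs = P vs ws * laplacian_mat G ws * P ws vs"
  proof (rule eq_matI)
    fix i j assume "i < dim_row (P vs ws * laplacian_mat G ws * P ws vs)"
      "j < dim_col (P vs ws * laplacian_mat G ws * P ws vs)"
    then have ij: "i < n" "j < n" by (auto simp: P_def)
    have PL: "(P vs ws * laplacian_mat G ws) $$ (i, k) = laplacian G (vs ! i) (ws ! k)"
      if "k < n" for k
    proof -
      have "(P vs ws * laplacian_mat G ws) $$ (i, k) =
            (\<Sum>l = 0..<length ws. of_bool (vs ! i = ws ! l) * laplacian G (ws ! l) (ws ! k))"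
        using ij that n by (simp add: P_def laplacian_mat_def scalar_prod_def)
      then show ?thesis
        using sum_nth_delta[of ws "vs ! i" "\<lambda>y. laplacian G y (ws ! k)"] assms in_ws ij by simp
    qed
    have "(P vs ws * laplacian_mat G ws * P ws vs) $$ (i, j) =
          (\<Sum>k = 0..<n. (P vs ws * laplacian_mat G ws) $$ (i, k) * P ws vs $$ (k, j))"
      using ij carrier_matD[OF P[of vs ws]] carrier_matD[OF P[of ws vs]] carrier_matD[OF L(2)]
      by (simp add: scalar_prod_def)
    also have "\<dots> = (\<Sum>k = 0..<length ws. of_bool (vs ! j = ws ! k) * laplacian G (vs ! i) (ws ! k))"
      using ij n PL by (intro sum.cong) (auto simp: P_def)
    also have "\<dots> = laplacian G (vs ! i) (vs ! j)"
      using sum_nth_delta[of ws "vs ! j" "\<lambda>y. laplacian G (vs ! i) y"] assms in_ws ij by simp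
    also have "\<dots> = laplacian_mat G vs $$ (i, j)"
      using ij n by (simp add: laplacian_mat_def)
    finally show "laplacian_mat G vs $$ (i, j) = (P vs ws * laplacian_mat G ws * P ws vs) $$ (i, j)" ..
  qed (auto simp: P_def laplacian_mat_def n)
  then have "similar_mat_wit (laplacian_mat G vs) (laplacian_mat G ws) (P vs ws) (P ws vs)"
    using P L one[of vs ws] one[of ws vs] assms n carrier_matD(1)[OF L(1)]
    unfolding similar_mat_wit_def Let_def by (metis empty_subsetI insert_subset)
  then show "similar_mat (laplacian_mat G vs) (laplacian_mat G ws)"
    by (auto simp: similar_mat_def)
qed

lemma laplacian_spectrum_eq:
  assumes "distinct vs" "set vs = pverts G"
  shows "laplacian_spectrum G = proots (char_poly (laplacian_mat G vs))"
proof -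
  have "distinct (SOME vs. distinct vs \<and> set vs = pverts G) \<and>
        set (SOME vs. distinct vs \<and> set vs = pverts G) = pverts G"
    by (rule someI[of "\<lambda>vs. distinct vs \<and> set vs = pverts G"]) (use assms in auto)
  then show ?thesis
    unfolding laplacian_spectrum_def using assms
    by (intro arg_cong[where f = proots] char_poly_laplacian_mat_cong) auto
qed

end

theory Submission
  imports Defs "Jordan_Normal_Form.Determinant"
begin

text \<open>
  Suppose that the Laplacian \<open>L\<close> has the eigenvalues \<open>0, \<dots>, n - 1\<close>, and let \<open>x\<close>, \<open>z\<close> be eigenvectors for
  \<open>1\<close> and \<open>n - 1\<close>; then \<open>z\<close> is an eigenvector for \<open>1\<close> of the Laplacian of the complement.
  As \<open>(L - 1) * (n - 1 - L)\<close> is positive semidefinite orthogonally to the constants, all degrees are at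
  least 2 and no vertex is the only exit from a set of vertices adjacent to it, and likewise in the
  complement. By a maximum principle, \<open>x\<close> then has a maximum \<open>i\<close> and a minimum \<open>j\<close> at distance at
  least 3, and \<open>z\<close> has a maximum \<open>k\<close> and a minimum \<open>l\<close> with the same property in the complement. Up to
  the sign of \<open>z\<close>, these four vertices form an induced path \<open>i, l, k, j\<close>.

  Every other vertex is adjacent to \<open>k\<close> or \<open>l\<close>, so that summing the eigenvalue equation over
  \<open>{v. 0 < x v}\<close> gives an exact balance between the values of \<open>x\<close> on the non-neighbours of \<open>k\<close> and of
  \<open>l\<close>; symmetrically for \<open>z\<close> and the neighbours of \<open>i\<close> and \<open>j\<close>. The four balances contradict each other
  when \<open>n \<ge> 8\<close>. For smaller \<open>n\<close>, the degrees force \<open>n \<ge> 6\<close>, and the trace \<open>n * (n - 1) / 2\<close>, being the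
  sum of the degrees, is even, which excludes 6 and 7.
\<close>

section \<open>Laplacians of finite graphs\<close>

definition compl_rel :: "('a \<Rightarrow> 'a \<Rightarrow> bool) \<Rightarrow> 'a \<Rightarrow> 'a \<Rightarrow> bool" where
  "compl_rel E u v \<longleftrightarrow> u \<noteq> v \<and> \<not> E u v"

definition nbs :: "'a set \<Rightarrow> ('a \<Rightarrow> 'a \<Rightarrow> bool) \<Rightarrow> 'a \<Rightarrow> 'a set" where
  "nbs V E v = {w \<in> V. E v w}"

definition lapl :: "'a set \<Rightarrow> ('a \<Rightarrow> 'a \<Rightarrow> bool) \<Rightarrow> ('a \<Rightarrow> real) \<Rightarrow> 'a \<Rightarrow> real" where
  "lapl V E f v = (\<Sum>w\<in>nbs V E v. f v - f w)"

locale fin_graph =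
  fixes V :: "'a set" and E :: "'a \<Rightarrow> 'a \<Rightarrow> bool"
  assumes finV: "finite V"
    and sym: "E u v \<Longrightarrow> E v u"
    and irr: "\<not> E v v"
begin

abbreviation "nb \<equiv> nbs V E"
abbreviation "conb \<equiv> nbs V (compl_rel E)"
abbreviation "lap \<equiv> lapl V E"
abbreviation "colap \<equiv> lapl V (compl_rel E)"

lemma finite_nbs [simp]: "finite (nbs V F v)"
  using finV by (auto simp: nbs_def)

lemma nbs_subset: "nbs V F v \<subseteq> V"
  by (auto simp: nbs_def)

text \<open>The summand is antisymmetric and adjacency is symmetric, so the two orientations of
  every edge inside \<open>U\<close> cancel. For \<open>U = V\<close> every function has a Laplacian
  of total zero; for smaller \<open>U\<close> only flow leaving \<open>U\<close> can
  survive.\<close>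

lemma flux_self_zero:
  assumes "U \<subseteq> V"
  shows "(\<Sum>v\<in>U. \<Sum>w\<in>{w\<in>U. E v w}. f v - f w) = (0::real)"
proof -
  have fU: "finite U" using assms finV finite_subset by blast
  have filt: "(\<Sum>v\<in>U. \<Sum>w\<in>{w\<in>U. E v w}. f v - f w) = (\<Sum>v\<in>U. \<Sum>w\<in>U. if E v w then f v - f w else 0)"
    by (rule sum.cong[OF refl], rule sum.inter_filter, rule fU)
  have "(\<Sum>v\<in>U. \<Sum>w\<in>U. if E v w then f v - f w else 0) = (\<Sum>v\<in>U. \<Sum>w\<in>U. if E w v then f w - f v else 0)"
    by (rule sum.swap)
  also have "\<dots> = - (\<Sum>v\<in>U. \<Sum>w\<in>U. if E v w then f v - f w else 0)"
    unfolding sum_negf[symmetric]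
  proof (intro sum.cong refl)
    fix v w
    show "(if E w v then f w - f v else 0) = - (if E v w then f v - f w else 0)"
      using sym[of v w] sym[of w v] by auto
  qed
  finally show ?thesis using filt by linarith
qed

lemma sum_lap: "(\<Sum>v\<in>V. lap f v) = 0"
  using flux_self_zero[of V f] by (simp add: lapl_def nbs_def)

lemma compl_graph: "fin_graph V (compl_rel E)"
  using finV sym by unfold_locales (auto simp: compl_rel_def)

lemma compl_compl: "compl_rel (compl_rel E) = E"
  using irr by (auto simp: compl_rel_def fun_eq_iff)

lemma mem_nb [simp]: "w \<in> nb v \<longleftrightarrow> w \<in> V \<and> E v w"
  by (simp add: nbs_def)

lemma mem_conb [simp]: "w \<in> conb v \<longleftrightarrow> w \<in> V \<and> w \<noteq> v \<and> \<not> E v w"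
  by (auto simp: nbs_def compl_rel_def)

lemma card_conb:
  assumes "v \<in> V"
  shows "card (nb v) + card (conb v) + 1 = card V"
proof -
  have "card V = card (insert v (nb v \<union> conb v))"
    using assms irr by (intro arg_cong[where f = card]) auto
  also have "\<dots> = Suc (card (nb v \<union> conb v))"
    using irr by (intro card_insert_disjoint) auto
  also have "card (nb v \<union> conb v) = card (nb v) + card (conb v)"
    by (intro card_Un_disjoint) auto
  finally show ?thesis by simp
qed

text \<open>The Laplacians of a graph and of its complement add up to that of the complete graph,
  \<open>n * I - J\<close> with \<open>J\<close> the all-ones matrix.\<close>

lemma lap_co:
  fixes f :: "'a \<Rightarrow> real"
  assumes "v \<in> V"
  shows "lap f v + colap f v = real (card V) * f v - (\<Sum>w\<in>V. f w)"
proof -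
  have "(\<Sum>w\<in>V. f v - f w) = (\<Sum>w\<in>nb v \<union> conb v. f v - f w)"
    using finV by (intro sum.mono_neutral_right) auto
  also have "\<dots> = lap f v + colap f v"
    unfolding lapl_def by (intro sum.union_disjoint) auto
  finally show ?thesis by (simp add: sum_subtractf)
qed

end

locale eigen_graph = fin_graph +
  fixes x :: "'a \<Rightarrow> real"
  assumes eig: "v \<in> V \<Longrightarrow> lap x v = x v"
begin

lemma sum_x: "(\<Sum>v\<in>V. x v) = 0"
  using sum_lap[of x] eig by simp

text \<open>As \<open>x\<close> has mean zero, it is an eigenfunction of the complement for
  \<open>n - 1\<close>, and \<open>n - 1\<close> is the number of neighbours plus the number of
  non-neighbours of \<open>v\<close>. The part from the non-neighbours cancels.\<close>

lemma sum_conb: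
  assumes "v \<in> V"
  shows "(\<Sum>w\<in>conb v. x w) = - real (card (nb v)) * x v"
proof -
  have "real (card (conb v)) = real (card V) - real (card (nb v)) - 1"
    using card_conb[OF assms] by linarith
  moreover have "colap x v = real (card (conb v)) * x v - (\<Sum>w\<in>conb v. x w)"
    by (simp add: lapl_def sum_subtractf)
  ultimately have "real (card V) * x v - x v =
      (real (card V) - real (card (nb v)) - 1) * x v - (\<Sum>w\<in>conb v. x w)"
    using lap_co[OF assms, of x] eig[OF assms] sum_x by simp
  then show ?thesis by (simp add: left_diff_distrib)
qed

end

section \<open>Flux through two dominating vertices\<close>

locale hubs = eigen_graph +
  fixes k l :: 'a
  assumes kV: "k \<in> V" and lV: "l \<in> V" and kl: "E k l"
    and dom: "v \<in> V \<Longrightarrow> v \<noteq> k \<Longrightarrow> v \<noteq> l \<Longrightarrow> E v k \<or> E v l"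
    and x_k: "x k \<le> 0" and x_l: "0 \<le> x l"
begin

definition cut :: "('a \<times> 'a) set" where
  "cut = {(u, w). u \<in> V - {k, l} \<and> w \<in> V - {k, l} \<and> E u w \<and> 0 < x u \<and> x w \<le> 0}"

definition leak :: real where
  "leak = (\<Sum>(u, w)\<in>cut. x u - x w)"

definition lows :: "'a set" where
  "lows = {v \<in> V - {k, l}. E v l \<and> x v \<le> 0}"

definition highs :: "'a set" where
  "highs = {v \<in> V - {k, l}. E v k \<and> 0 < x v}"

text \<open>
  Outside \<open>{k, l}\<close> the equation at \<open>v\<close> reads: the flow \<open>\<Sum>w. x v - x w\<close> to the other vertices outside
  \<open>{k, l}\<close> is \<open>x l\<close>, \<open>x k\<close> or \<open>x k + x l - x v\<close>, as \<open>v\<close> is adjacent to \<open>l\<close> only, to \<open>k\<close> only, or to both.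
  Summing over the vertices with \<open>0 < x v\<close> leaves only the flow across \<open>cut\<close>.
\<close>

lemma flux:
  "(\<Sum>v\<in>conb l. max (- x v) 0) =
     (\<Sum>v\<in>V - conb k. max (x v) 0) + leak + x l * card lows - x k * card highs"
proof -
  define V0 where "V0 = V - {k, l}"
  define U where "U = {v \<in> V0. 0 < x v}"
  have fin: "finite V0" "finite U" using finV by (auto simp: V0_def U_def)
  have kl': "k \<noteq> l" using kl irr by auto
  have g: "(\<Sum>w\<in>{w\<in>V0. E v w}. x v - x w) =
      of_bool (E v l) * x l + of_bool (E v k) * x k - of_bool (E v k \<and> E v l) * x v" if v: "v \<in> V0" for v
  proof -
    have eq: "nb v = {w\<in>V0. E v w} \<union> ({k} \<inter> {w. E v w}) \<union> ({l} \<inter> {w. E v w})"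
      using kV lV by (auto simp: V0_def)
    have "x v = (\<Sum>w\<in>nb v. x v - x w)" using eig[of v] v by (simp add: lapl_def V0_def)
    also have "\<dots> = (\<Sum>w\<in>{w\<in>V0. E v w}. x v - x w) + (\<Sum>w\<in>{k} \<inter> {w. E v w}. x v - x w)
        + (\<Sum>w\<in>{l} \<inter> {w. E v w}. x v - x w)"
      unfolding eq using fin kl' by (subst sum.union_disjoint; (subst sum.union_disjoint)?) (auto simp: V0_def)
    also have "(\<Sum>w\<in>{k} \<inter> {w. E v w}. x v - x w) = of_bool (E v k) * (x v - x k)" by (auto simp: Int_insert_left)
    also have "(\<Sum>w\<in>{l} \<inter> {w. E v w}. x v - x w) = of_bool (E v l) * (x v - x l)" by (auto simp: Int_insert_left)
    finally have "(\<Sum>w\<in>{w\<in>V0. E v w}. x v - x w) =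
        x v - of_bool (E v k) * (x v - x k) - of_bool (E v l) * (x v - x l)" by linarith
    moreover have "E v k \<or> E v l" using dom v by (auto simp: V0_def)
    ultimately show ?thesis by (cases "E v k"; cases "E v l"; simp)
  qed
  have "leak = (\<Sum>u\<in>U. \<Sum>w\<in>{w\<in>V0 - U. E u w}. x u - x w)"
  proof -
    have "cut = Sigma U (\<lambda>u. {w\<in>V0 - U. E u w})" by (auto simp: cut_def U_def V0_def)
    then show ?thesis unfolding leak_def using fin by (simp add: sum.Sigma)
  qed
  also have "\<dots> = (\<Sum>u\<in>U. (\<Sum>w\<in>{w\<in>V0. E u w}. x u - x w) - (\<Sum>w\<in>{w\<in>U. E u w}. x u - x w))"
  proof (intro sum.cong refl)
    fix u assume "u \<in> U"
    have "{w\<in>V0. E u w} = {w\<in>V0 - U. E u w} \<union> {w\<in>U. E u w}" by (auto simp: U_def)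
    then have "(\<Sum>w\<in>{w\<in>V0. E u w}. x u - x w) = (\<Sum>w\<in>{w\<in>V0 - U. E u w}. x u - x w) + (\<Sum>w\<in>{w\<in>U. E u w}. x u - x w)"
      using fin by (auto intro!: sum.union_disjoint)
    then show "(\<Sum>w\<in>{w\<in>V0 - U. E u w}. x u - x w) = (\<Sum>w\<in>{w\<in>V0. E u w}. x u - x w) - (\<Sum>w\<in>{w\<in>U. E u w}. x u - x w)"
      by simp
  qed
  also have "\<dots> = (\<Sum>u\<in>U. \<Sum>w\<in>{w\<in>V0. E u w}. x u - x w)"
    using flux_self_zero[of U x] by (simp add: sum_subtractf U_def V0_def)
  also have "\<dots> = (\<Sum>u\<in>U. of_bool (E u l) * x l + of_bool (E u k) * x k - of_bool (E u k \<and> E u l) * x u)"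
    by (intro sum.cong refl g) (auto simp: U_def)
  also have "\<dots> = x l * card {u\<in>U. E u l} + x k * card {u\<in>U. E u k} - (\<Sum>u\<in>{u\<in>U. E u k \<and> E u l}. x u)"
  proof -
    have 1: "(\<Sum>u\<in>U. of_bool (E u y) * c) = c * card {u\<in>U. E u y}" for y and c :: real
    proof -
      have "(\<Sum>u\<in>U. of_bool (E u y) * c) = (\<Sum>u\<in>U. if E u y then c else 0)"
        by (intro sum.cong) auto
      also have "\<dots> = (\<Sum>u\<in>{u\<in>U. E u y}. c)"
        by (rule sum.inter_filter[symmetric]) (rule fin)
      finally show ?thesis by simp
    qed
    have 2: "(\<Sum>u\<in>U. of_bool (E u k \<and> E u l) * x u) = (\<Sum>u\<in>{u\<in>U. E u k \<and> E u l}. x u)"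
    proof -
      have "(\<Sum>u\<in>U. of_bool (E u k \<and> E u l) * x u) = (\<Sum>u\<in>U. if E u k \<and> E u l then x u else 0)"
        by (intro sum.cong) auto
      also have "\<dots> = (\<Sum>u\<in>{u\<in>U. E u k \<and> E u l}. x u)"
        by (rule sum.inter_filter[symmetric]) (rule fin)
      finally show ?thesis .
    qed
    show ?thesis by (simp only: sum.distrib sum_subtractf 1 2)
  qed
  finally have leak: "leak = x l * card {u\<in>U. E u l} + x k * card {u\<in>U. E u k} - (\<Sum>u\<in>{u\<in>U. E u k \<and> E u l}. x u)" .
  have hi: "highs = {u\<in>U. E u k}" by (auto simp: highs_def U_def V0_def)
  have lo: "card {v\<in>V0. E v l} = card lows + card {u\<in>U. E u l}"
  proof -
    have "{v\<in>V0. E v l} = lows \<union> {u\<in>U. E u l}" by (auto simp: lows_def U_def V0_def)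
    moreover have "finite lows" using finV by (auto simp: lows_def)
    ultimately show ?thesis using fin by (auto simp: lows_def U_def intro!: card_Un_disjoint)
  qed
  have nbl: "nb l = insert k {v\<in>V0. E v l}" using kV kl sym irr by (auto simp: V0_def)
  \<comment> \<open>The equation at \<open>l\<close> evaluates the sum of \<open>x\<close> over the
    neighbours of \<open>l\<close>; since \<open>x\<close> has total zero, this also gives the sum
    over \<open>conb l\<close>.\<close>
  have l_eq: "(\<Sum>v\<in>{v\<in>V0. E v l}. x v) = x l * card {v\<in>V0. E v l} - x k"
  proof -
    have "(\<Sum>w\<in>nb l. x l - x w) = x l" using eig[OF lV] by (simp add: lapl_def)
    then have "x l - x k + (\<Sum>v\<in>{v\<in>V0. E v l}. x l - x v) = x l"
      unfolding nbl using fin by (subst (asm) sum.insert) (auto simp: V0_def)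
    then show ?thesis by (simp add: sum_subtractf algebra_simps)
  qed
  have La: "conb l = {v\<in>V0. \<not> E v l}" using kl sym irr by (auto simp: V0_def)
  have VK: "V - conb k = insert k (insert l {v\<in>V0. E v k})"
    using kV lV kl sym by (auto simp: V0_def)
  have "(\<Sum>v\<in>V - conb k. max (x v) 0) = x l + (\<Sum>v\<in>{v\<in>V0. E v k}. max (x v) 0)"
    unfolding VK using fin kl' x_k x_l by (simp add: V0_def max_def)
  also have "(\<Sum>v\<in>{v\<in>V0. E v k}. max (x v) 0) = (\<Sum>v\<in>{u\<in>U. E u k}. x v)"
    using fin by (intro sum.mono_neutral_cong_right) (auto simp: U_def)
  also have "\<dots> = (\<Sum>v\<in>{u\<in>U. E u k \<and> E u l}. x v) + (\<Sum>v\<in>{u\<in>U. \<not> E u l}. x v)"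
  proof -
    have "{u\<in>U. E u k} = {u\<in>U. E u k \<and> E u l} \<union> {u\<in>U. \<not> E u l}"
      using dom by (auto simp: U_def V0_def)
    then show ?thesis using fin by (auto intro!: sum.union_disjoint)
  qed
  finally have pos: "(\<Sum>v\<in>V - conb k. max (x v) 0) = x l + ((\<Sum>v\<in>{u\<in>U. E u k \<and> E u l}. x v) + (\<Sum>v\<in>{u\<in>U. \<not> E u l}. x v))" .
  have "(\<Sum>v\<in>conb l. max (- x v) 0) = (\<Sum>v\<in>conb l. (if 0 < x v then x v else 0) - x v)"
    by (intro sum.cong) auto
  also have "\<dots> = (\<Sum>v\<in>{u\<in>U. \<not> E u l}. x v) - (\<Sum>v\<in>conb l. x v)"
  proof -
    have "(\<Sum>v\<in>conb l. if 0 < x v then x v else 0) = (\<Sum>v\<in>{v\<in>conb l. 0 < x v}. x v)"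
      by (rule sum.inter_filter[symmetric]) simp
    moreover have "{v\<in>conb l. 0 < x v} = {u\<in>U. \<not> E u l}" by (auto simp: La U_def)
    ultimately show ?thesis by (simp add: sum_subtractf)
  qed
  finally have neg: "(\<Sum>v\<in>conb l. max (- x v) 0) = (\<Sum>v\<in>{u\<in>U. \<not> E u l}. x v) - (\<Sum>v\<in>conb l. x v)" .
  have "0 = x k + (x l + (\<Sum>v\<in>V0. x v))"
  proof -
    have "(\<Sum>v\<in>V. x v) = (\<Sum>v\<in>insert k (insert l V0). x v)"
      using kV lV by (intro sum.cong) (auto simp: V0_def)
    also have "\<dots> = x k + (x l + (\<Sum>v\<in>V0. x v))" using fin kl' by (simp add: V0_def)
    finally show ?thesis using sum_x by simp
  qed
  moreover have "(\<Sum>v\<in>V0. x v) = (\<Sum>v\<in>{v\<in>V0. E v l}. x v) + (\<Sum>v\<in>conb l. x v)"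
  proof -
    have "(\<Sum>v\<in>V0. x v) = (\<Sum>v\<in>{v\<in>V0. E v l} \<union> conb l. x v)"
      by (intro sum.cong) (auto simp: La)
    also have "\<dots> = (\<Sum>v\<in>{v\<in>V0. E v l}. x v) + (\<Sum>v\<in>conb l. x v)"
      using fin by (intro sum.union_disjoint) (auto simp: La)
    finally show ?thesis .
  qed
  moreover have "x l * card {v\<in>V0. E v l} = x l * card lows + x l * card {u\<in>U. E u l}"
    by (simp add: lo distrib_left)
  ultimately show ?thesis
    using leak pos neg l_eq hi by simp
qed

text \<open>The positive and the negative part of \<open>x\<close> have the same total over
  \<open>V\<close>, so passing to complementary sets on both sides of \<open>flux\<close> exchanges
  the sides and keeps the remaining terms.\<close>

lemma flux':
  "(\<Sum>v\<in>conb k. max (x v) 0) =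
     (\<Sum>v\<in>V - conb l. max (- x v) 0) + leak + x l * card lows - x k * card highs"
proof -
  have split: "(\<Sum>v\<in>V. f v) = (\<Sum>v\<in>conb y. f v) + (\<Sum>v\<in>V - conb y. f v)" for f :: "'a \<Rightarrow> real" and y
    using finV sum.subset_diff[OF nbs_subset[of "compl_rel E" y] finV, of f] by simp
  have "(\<Sum>v\<in>V. max (x v) 0) - (\<Sum>v\<in>V. max (- x v) 0) = (\<Sum>v\<in>V. x v)"
    by (subst sum_subtractf[symmetric]) (intro sum.cong, auto)
  then show ?thesis
    using split[of "\<lambda>v. max (x v) 0" k] split[of "\<lambda>v. max (- x v) 0" l] flux sum_x by linarith
qed

section \<open>Lower bounds for \<open>leak\<close> from pairs known to lie in
  \<open>cut\<close>\<close>

lemma finite_cut: "finite cut"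
  by (rule finite_subset[of _ "V \<times> V"]) (use finV in \<open>auto simp: cut_def\<close>)

lemma leak_ge:
  assumes "F \<subseteq> cut"
  shows "(\<Sum>(u, w)\<in>F. x u - x w) \<le> leak"
  unfolding leak_def using assms finite_cut by (intro sum_mono2) (auto simp: cut_def)

lemma leak_nonneg: "0 \<le> leak"
  using leak_ge[of "{}"] by simp

lemma leak_one: "(u, w) \<in> cut \<Longrightarrow> x u - x w \<le> leak"
  using leak_ge[of "{(u, w)}"] by simp

lemma leak_two_down:
  assumes "\<And>w. w \<in> T1 \<Longrightarrow> (u1, w) \<in> cut" "\<And>w. w \<in> T2 \<Longrightarrow> (u2, w) \<in> cut" "u1 \<noteq> u2"
  shows "(\<Sum>w\<in>T1. x u1 - x w) + (\<Sum>w\<in>T2. x u2 - x w) \<le> leak"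
proof -
  have "T1 \<subseteq> snd ` cut" "T2 \<subseteq> snd ` cut" using assms by force+
  then have fin: "finite T1" "finite T2" using finite_cut finite_subset by blast+
  have "(\<Sum>(u, w)\<in>Pair u1 ` T1 \<union> Pair u2 ` T2. x u - x w) =
      (\<Sum>(u, w)\<in>Pair u1 ` T1. x u - x w) + (\<Sum>(u, w)\<in>Pair u2 ` T2. x u - x w)"
    using fin assms(3) by (intro sum.union_disjoint) auto
  moreover have "(\<Sum>(u, w)\<in>Pair a ` T. x u - x w) = (\<Sum>w\<in>T. x a - x w)" for a T
    by (subst sum.reindex) (auto simp: inj_on_def)
  ultimately show ?thesis
    using leak_ge[of "Pair u1 ` T1 \<union> Pair u2 ` T2"] assms by auto
qed

lemma leak_down:
  assumes "\<And>w. w \<in> T \<Longrightarrow> (u, w) \<in> cut" "finite T"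
  shows "(\<Sum>w\<in>T. x u - x w) \<le> leak"
proof -
  have "(\<Sum>(u, w)\<in>Pair u ` T. x u - x w) = (\<Sum>w\<in>T. x u - x w)"
    by (subst sum.reindex) (auto simp: inj_on_def)
  then show ?thesis using leak_ge[of "Pair u ` T"] assms by auto
qed

text \<open>The star entering \<open>v\<close> and the star leaving \<open>r\<close> could share
  only the pair \<open>(r, v)\<close>, which \<open>r \<notin> T1\<close> excludes; hence their
  contributions add up.\<close>

lemma leak_up_down:
  assumes "\<And>u. u \<in> T1 \<Longrightarrow> (u, v) \<in> cut" "\<And>w. w \<in> T2 \<Longrightarrow> (r, w) \<in> cut" "r \<notin> T1"
  shows "(\<Sum>u\<in>T1. x u - x v) + (\<Sum>w\<in>T2. x r - x w) \<le> leak"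
proof -
  have "T1 \<subseteq> fst ` cut" "T2 \<subseteq> snd ` cut" using assms by force+
  then have fin: "finite T1" "finite T2" using finite_cut finite_subset by blast+
  have "(\<Sum>(u, w)\<in>(\<lambda>u. (u, v)) ` T1 \<union> Pair r ` T2. x u - x w) =
      (\<Sum>(u, w)\<in>(\<lambda>u. (u, v)) ` T1. x u - x w) + (\<Sum>(u, w)\<in>Pair r ` T2. x u - x w)"
    using fin assms(3) by (intro sum.union_disjoint) auto
  moreover have "(\<Sum>(u, w)\<in>Pair r ` T2. x u - x w) = (\<Sum>w\<in>T2. x r - x w)"
    by (subst sum.reindex) (auto simp: inj_on_def)
  moreover have "(\<Sum>(u, w)\<in>(\<lambda>u. (u, v)) ` T1. x u - x w) = (\<Sum>u\<in>T1. x u - x v)"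
    by (subst sum.reindex) (auto simp: inj_on_def)
  ultimately show ?thesis
    using leak_ge[of "(\<lambda>u. (u, v)) ` T1 \<union> Pair r ` T2"] assms by auto
qed

lemma mem_cut: "(u, w) \<in> cut \<longleftrightarrow> u \<in> V \<and> u \<noteq> k \<and> u \<noteq> l \<and> w \<in> V \<and> w \<noteq> k \<and> w \<noteq> l \<and> E u w \<and> 0 < x u \<and> x w \<le> 0"
  by (auto simp: cut_def)

lemma mem_lows: "v \<in> lows \<longleftrightarrow> v \<in> V \<and> v \<noteq> k \<and> v \<noteq> l \<and> E v l \<and> x v \<le> 0"
  by (auto simp: lows_def)

lemma mem_highs: "v \<in> highs \<longleftrightarrow> v \<in> V \<and> v \<noteq> k \<and> v \<noteq> l \<and> E v k \<and> 0 < x v"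
  by (auto simp: highs_def)

lemma finite_lows: "finite lows" and finite_highs: "finite highs"
  using finV by (auto simp: lows_def highs_def)

end

section \<open>Extremal configurations\<close>

text \<open>
  The vertices \<open>i, l, k, j\<close> form an induced path; \<open>i, j\<close> are extremal for \<open>x\<close> and have no common
  neighbour, \<open>k, l\<close> are extremal for \<open>z\<close> and have no common non-neighbour.
\<close>

locale extremal_config = fin_graph +
  fixes x z :: "'a \<Rightarrow> real" and i j k l :: 'a
  assumes eigx: "v \<in> V \<Longrightarrow> lap x v = x v"
    and eigz: "v \<in> V \<Longrightarrow> colap z v = z v"
    and iV: "i \<in> V" and jV: "j \<in> V" and kV: "k \<in> V" and lV: "l \<in> V"
    and x_le: "v \<in> V \<Longrightarrow> x v \<le> x i" and x_ge: "v \<in> V \<Longrightarrow> x j \<le> x v"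
    and z_le: "v \<in> V \<Longrightarrow> z v \<le> z k" and z_ge: "v \<in> V \<Longrightarrow> z l \<le> z v"
    and x_i: "0 < x i" and x_j: "x j < 0" and z_k: "0 < z k" and z_l: "z l < 0"
    and il: "E i l" and kj: "E k j" and kl: "E k l"
    and ik: "\<not> E i k" and jl: "\<not> E j l" and ij: "\<not> E i j"
    and neq: "i \<noteq> k" "j \<noteq> l" "i \<noteq> j"
    and disj: "v \<in> V \<Longrightarrow> \<not> (E i v \<and> E j v)"
    and dom: "v \<in> V \<Longrightarrow> v \<noteq> k \<Longrightarrow> v \<noteq> l \<Longrightarrow> E v k \<or> E v l"
    and deg: "v \<in> V \<Longrightarrow> 2 \<le> card (nb v)" and codeg: "v \<in> V \<Longrightarrow> 2 \<le> card (conb v)"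
begin

text \<open>
  Complementation, combined with \<open>(x, z) \<mapsto> (z, - x)\<close>, is a symmetry of order four; it permutes the
  cells \<open>P, R, Q, S\<close> below cyclically.
\<close>

lemma rot: "extremal_config V (compl_rel E) z (\<lambda>v. - x v) k l j i"
proof -
  interpret co: fin_graph V "compl_rel E" by (rule compl_graph)
  have neg: "lapl V E (\<lambda>v. - x v) v = - lap x v" for v
    by (simp add: lapl_def sum_negf[symmetric])
  have cc: "compl_rel E u v \<longleftrightarrow> u \<noteq> v \<and> \<not> E u v" for u v
    by (simp add: compl_rel_def)
  have ne: "k \<noteq> j" "l \<noteq> i" "k \<noteq> l" using kj il kl irr by auto
  show ?thesis
    apply unfold_locales
    subgoal using eigz by simp
    subgoal using eigx by (simp add: compl_compl neg)
    subgoal by (rule kV)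
    subgoal by (rule lV)
    subgoal by (rule jV)
    subgoal by (rule iV)
    subgoal by (rule z_le)
    subgoal by (rule z_ge)
    subgoal using x_ge by simp
    subgoal using x_le by simp
    subgoal by (rule z_k)
    subgoal by (rule z_l)
    subgoal using x_j by simp
    subgoal using x_i by simp
    subgoal using ik neq sym by (auto simp: cc)
    subgoal using jl neq by (auto simp: cc)
    subgoal using ij neq sym by (auto simp: cc)
    subgoal using kj by (auto simp: cc)
    subgoal using il sym by (auto simp: cc)
    subgoal using kl by (auto simp: cc)
    subgoal using ne by simp
    subgoal using ne by simp
    subgoal using ne by simp
    subgoal for v using dom[of v] sym by (auto simp: cc)
    subgoal for v using disj[of v] sym by (auto simp: cc)
    subgoal by (rule codeg)
    subgoal using deg by (simp add: compl_compl)
    done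
qed

text \<open>At the maximum \<open>i\<close> the terms of the equation are nonnegative and sum to
  \<open>x i\<close>, so the one belonging to \<open>l\<close> is at most
  \<open>x i\<close>.\<close>

lemma x_l: "0 \<le> x l"
proof -
  have "x i - x l \<le> (\<Sum>w\<in>nb i. x i - x w)"
    using il lV x_le by (intro member_le_sum) auto
  then show ?thesis using eigx[OF iV] by (simp add: lapl_def)
qed

section \<open>The four cells around the path and the two balances for \<open>x\<close>\<close>

abbreviation "P \<equiv> nb i - {l}"
abbreviation "R \<equiv> conb k - {i}"
abbreviation "Q \<equiv> nb j - {k}"
abbreviation "S \<equiv> conb l - {j}"
abbreviation "B \<equiv> V - {i, j, k, l} - P - Q - R - S"

text \<open>The equation at \<open>i\<close> with the term of \<open>l\<close> removed. Thus
  \<open>x l\<close> is the whole deficit of \<open>x\<close> on \<open>P\<close> below its maximum,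
  and it bounds every partial deficit.\<close>

lemma sum_P: "(\<Sum>v\<in>P. x i - x v) = x l"
proof -
  have "(\<Sum>w\<in>nb i. x i - x w) = (x i - x l) + (\<Sum>v\<in>P. x i - x v)"
    using il lV by (intro sum.remove) auto
  then show ?thesis using eigx[OF iV] by (simp add: lapl_def)
qed

lemma P_ne: "P \<noteq> {}"
proof
  assume "P = {}"
  then have "card (nb i) \<le> card {l}" by (intro card_mono) auto
  then show False using deg[OF iV] by simp
qed

lemma rot2: "extremal_config V E (\<lambda>v. - x v) (\<lambda>v. - z v) j i l k"
  using extremal_config.rot[OF rot] by (simp add: compl_compl)

lemma rot3: "extremal_config V (compl_rel E) (\<lambda>v. - z v) x l k i j"
  using extremal_config.rot[OF rot2] by simp

lemma R_ne: "R \<noteq> {}" by (rule extremal_config.P_ne[OF rot])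
lemma S_ne: "S \<noteq> {}" by (rule extremal_config.P_ne[OF rot3])

lemma x_k: "x k \<le> 0" using extremal_config.x_l[OF rot2] by simp
lemma z_i: "0 \<le> z i" by (rule extremal_config.x_l[OF rot])
lemma z_j: "z j \<le> 0" using extremal_config.x_l[OF rot3] by simp

sublocale xh: hubs V E x k l
  using eigx kV lV kl dom x_k x_l by unfold_locales auto

text \<open>If \<open>l\<close> were a maximum, its equation would force \<open>x k = 0\<close> and
  maximality of \<open>x\<close> at all neighbours of \<open>l\<close> but \<open>k\<close>. These
  include all non-neighbours of \<open>k\<close>, where \<open>x\<close> sums to zero by
  \<open>sum_conb\<close>: a contradiction.\<close>

lemma x_l_less: "x l < x i"
proof (rule ccontr)
  assume "\<not> x l < x i"
  then have eq: "x l = x i" using x_le[OF lV] by simp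
  have "(\<Sum>w\<in>nb l. x l - x w) = (x l - x k) + (\<Sum>w\<in>nb l - {k}. x l - x w)"
    using kl sym kV by (intro sum.remove) auto
  then have "(\<Sum>w\<in>nb l - {k}. x l - x w) = x k" using eigx[OF lV] by (simp add: lapl_def)
  moreover have nn: "\<And>w. w \<in> nb l - {k} \<Longrightarrow> 0 \<le> x l - x w" using x_le eq by auto
  moreover have "0 \<le> (\<Sum>w\<in>nb l - {k}. x l - x w)" by (rule sum_nonneg) (rule nn)
  ultimately have "x k = 0" using x_k by linarith
  with \<open>(\<Sum>w\<in>nb l - {k}. x l - x w) = x k\<close> have const: "x w = x i" if "w \<in> nb l - {k}" for w
    using that nn eq sum_nonneg_eq_0_iff[of "nb l - {k}" "\<lambda>w. x l - x w"] by auto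
  have "(\<Sum>w\<in>conb k. x w) = 0" using xh.sum_conb[OF kV] \<open>x k = 0\<close> by simp
  moreover have "0 < (\<Sum>w\<in>conb k. x w)"
  proof (rule sum_pos)
    have "i \<in> conb k" using iV ik neq sym by auto
    then show "conb k \<noteq> {}" by blast
    fix w assume w: "w \<in> conb k"
    then have "E w l" using dom[of w] kl sym by auto
    then show "0 < x w" using const[of w] w x_i sym by auto
  qed simp
  ultimately show False by simp
qed

lemma z_i_less: "z i < z k" by (rule extremal_config.x_l_less[OF rot])

lemma P_ge: "p \<in> P \<Longrightarrow> x i - x l \<le> x p"
proof -
  assume "p \<in> P"
  then have "x i - x p \<le> (\<Sum>v\<in>P. x i - x v)" using x_le by (intro member_le_sum) auto
  then show ?thesis using sum_P by simp
qed

lemma P_pos: "p \<in> P \<Longrightarrow> 0 < x p"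
  using P_ge x_l_less by force

lemma R_ge: "r \<in> R \<Longrightarrow> z k - z i \<le> z r" by (rule extremal_config.P_ge[OF rot])
lemma R_pos: "r \<in> R \<Longrightarrow> 0 < z r" by (rule extremal_config.P_pos[OF rot])
lemma Q_neg: "q \<in> Q \<Longrightarrow> x q < 0" using extremal_config.P_pos[OF rot2] by simp
lemma S_le: "s \<in> S \<Longrightarrow> z s \<le> z l - z j" using extremal_config.P_ge[OF rot3] by force
lemma S_neg: "s \<in> S \<Longrightarrow> z s < 0" using extremal_config.P_pos[OF rot3] by simp

lemma PQ: "P \<inter> Q = {}" using disj by auto
lemma RS: "R \<inter> S = {}" using extremal_config.PQ[OF rot] by simp

lemma out: "P \<subseteq> V - {i, j, k, l}"
  using ik ij irr sym by auto

lemma outs: "P \<union> Q \<union> R \<union> S \<subseteq> V - {i, j, k, l}"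
  using out extremal_config.out[OF rot] extremal_config.out[OF rot2] extremal_config.out[OF rot3] by blast

lemma sum_P_sub: "T \<subseteq> P \<Longrightarrow> x i * card T \<le> x l + (\<Sum>v\<in>T. x v)"
proof -
  assume T: "T \<subseteq> P"
  then have "(\<Sum>v\<in>T. x i - x v) \<le> (\<Sum>v\<in>P. x i - x v)"
    using x_le by (intro sum_mono2) auto
  then show ?thesis using sum_P by (simp add: sum_subtractf mult.commute)
qed

lemma sum_Q_sub: "T \<subseteq> Q \<Longrightarrow> - x j * card T \<le> - x k + (\<Sum>v\<in>T. - x v)"
  by (rule extremal_config.sum_P_sub[OF rot2])

text \<open>This is \<open>flux\<close> with part of the sum over \<open>V - conb k\<close> dropped:
  the vertex \<open>l\<close> and the sets \<open>P - R\<close>, \<open>S - P\<close>,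
  \<open>B\<close> are disjoint parts of it. The summand \<open>x l\<close> pays for the deficit on
  \<open>P - R\<close>, so that each of its vertices counts as a full \<open>x i\<close>.\<close>

lemma xa:
  "x i * card (P - R) + (\<Sum>v\<in>S - P. max (x v) 0) + (\<Sum>v\<in>B. max (x v) 0)
     + xh.leak + x l * card xh.lows - x k * card xh.highs \<le> - x j + (\<Sum>v\<in>S. max (- x v) 0)"
proof -
  have "(\<Sum>v\<in>conb l. max (- x v) 0) = max (- x j) 0 + (\<Sum>v\<in>S. max (- x v) 0)"
    using jV jl neq sym by (intro sum.remove) auto
  then have 1: "(\<Sum>v\<in>conb l. max (- x v) 0) = - x j + (\<Sum>v\<in>S. max (- x v) 0)"
    using x_j by simp
  have "(\<Sum>v\<in>insert l ((P - R) \<union> (S - P) \<union> B). max (x v) 0) \<le> (\<Sum>v\<in>V - conb k. max (x v) 0)"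
  proof (rule sum_mono2)
    have "V - conb k = insert k (nb k)" using kV by auto
    show "insert l ((P - R) \<union> (S - P) \<union> B) \<subseteq> V - conb k"
      using lV kl RS outs irr by auto
  qed (use finV in auto)
  moreover have "(\<Sum>v\<in>insert l ((P - R) \<union> (S - P) \<union> B). max (x v) 0) =
      x l + (\<Sum>v\<in>P - R. max (x v) 0) + (\<Sum>v\<in>S - P. max (x v) 0) + (\<Sum>v\<in>B. max (x v) 0)"
  proof -
    have "l \<notin> (P - R) \<union> (S - P) \<union> B" using outs by auto
    then have "(\<Sum>v\<in>insert l ((P - R) \<union> (S - P) \<union> B). max (x v) 0) =
      max (x l) 0 + (\<Sum>v\<in>(P - R) \<union> (S - P) \<union> B. max (x v) 0)" using finV by (subst sum.insert) auto
    also have "(\<Sum>v\<in>(P - R) \<union> (S - P) \<union> B. max (x v) 0) =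
       (\<Sum>v\<in>(P - R) \<union> (S - P). max (x v) 0) + (\<Sum>v\<in>B. max (x v) 0)"
      using finV by (intro sum.union_disjoint) auto
    also have "(\<Sum>v\<in>(P - R) \<union> (S - P). max (x v) 0) = (\<Sum>v\<in>P - R. max (x v) 0) + (\<Sum>v\<in>S - P. max (x v) 0)"
      using finV by (intro sum.union_disjoint) auto
    finally show ?thesis using x_l by simp
  qed
  moreover have "(\<Sum>v\<in>P - R. max (x v) 0) = (\<Sum>v\<in>P - R. x v)"
    by (intro sum.cong refl max_absorb1 less_imp_le P_pos) (erule DiffD1)
  moreover have "x i * card (P - R) \<le> x l + (\<Sum>v\<in>P - R. x v)" by (intro sum_P_sub) auto
  ultimately show ?thesis using xh.flux 1 by linarith
qed

text \<open>The mirror image of \<open>xa\<close>, taken from \<open>flux'\<close> and not from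
  \<open>rot2\<close>: negating \<open>x\<close> would move its zeros to the other side of the cut,
  whereas here \<open>leak\<close>, \<open>lows\<close> and \<open>highs\<close> stay the same as in
  \<open>xa\<close>.\<close>

lemma xb:
  "- x j * card (Q - S) + (\<Sum>v\<in>R - Q. max (- x v) 0) + (\<Sum>v\<in>B. max (- x v) 0)
     + xh.leak + x l * card xh.lows - x k * card xh.highs \<le> x i + (\<Sum>v\<in>R. max (x v) 0)"
proof -
  have "(\<Sum>v\<in>conb k. max (x v) 0) = max (x i) 0 + (\<Sum>v\<in>R. max (x v) 0)"
    using iV ik neq sym by (intro sum.remove) auto
  then have 1: "(\<Sum>v\<in>conb k. max (x v) 0) = x i + (\<Sum>v\<in>R. max (x v) 0)"
    using x_i by simp
  have "(\<Sum>v\<in>insert k ((Q - S) \<union> (R - Q) \<union> B). max (- x v) 0) \<le> (\<Sum>v\<in>V - conb l. max (- x v) 0)"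
  proof (rule sum_mono2)
    show "insert k ((Q - S) \<union> (R - Q) \<union> B) \<subseteq> V - conb l"
      using kV kl sym RS outs irr by auto
  qed (use finV in auto)
  moreover have "(\<Sum>v\<in>insert k ((Q - S) \<union> (R - Q) \<union> B). max (- x v) 0) =
      - x k + (\<Sum>v\<in>Q - S. max (- x v) 0) + (\<Sum>v\<in>R - Q. max (- x v) 0) + (\<Sum>v\<in>B. max (- x v) 0)"
  proof -
    have "k \<notin> (Q - S) \<union> (R - Q) \<union> B" using outs by auto
    then have "(\<Sum>v\<in>insert k ((Q - S) \<union> (R - Q) \<union> B). max (- x v) 0) =
      max (- x k) 0 + (\<Sum>v\<in>(Q - S) \<union> (R - Q) \<union> B. max (- x v) 0)" using finV by (subst sum.insert) auto
    also have "(\<Sum>v\<in>(Q - S) \<union> (R - Q) \<union> B. max (- x v) 0) =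
       (\<Sum>v\<in>(Q - S) \<union> (R - Q). max (- x v) 0) + (\<Sum>v\<in>B. max (- x v) 0)"
      using finV by (intro sum.union_disjoint) auto
    also have "(\<Sum>v\<in>(Q - S) \<union> (R - Q). max (- x v) 0) = (\<Sum>v\<in>Q - S. max (- x v) 0) + (\<Sum>v\<in>R - Q. max (- x v) 0)"
      using finV by (intro sum.union_disjoint) auto
    finally show ?thesis using x_k by simp
  qed
  moreover have "(\<Sum>v\<in>Q - S. max (- x v) 0) = (\<Sum>v\<in>Q - S. - x v)"
  proof (intro sum.cong refl max_absorb1)
    fix v assume "v \<in> Q - S"
    then have "x v < 0" by (intro Q_neg) (erule DiffD1)
    then show "0 \<le> - x v" by simp
  qed
  moreover have "- x j * card (Q - S) \<le> - x k + (\<Sum>v\<in>Q - S. - x v)" by (intro sum_Q_sub) auto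
  ultimately show ?thesis using xh.flux' 1 by linarith
qed

end

section \<open>The configuration cannot occur\<close>

text \<open>The order assumptions let an upper bound \<open>- x j\<close> or \<open>- z l\<close> in
  a balance be replaced by \<open>x i\<close> or \<open>z k\<close>. The bound on
  \<open>card V\<close> supplies vertices beyond the path and two named ones.\<close>

locale ordered_config = extremal_config +
  assumes x_ord: "- x j \<le> x i" and z_ord: "- z l \<le> z k" and card_V: "8 \<le> card V"
begin

section \<open>The balances for \<open>z\<close>, with \<open>j\<close> and \<open>i\<close> as hubs
  of the complement, and tools for using them\<close>

abbreviation "zcut \<equiv> hubs.cut V (compl_rel E) z j i"
abbreviation "zleak \<equiv> hubs.leak V (compl_rel E) z j i"
abbreviation "zlows \<equiv> hubs.lows V (compl_rel E) z j i"
abbreviation "zhighs \<equiv> hubs.highs V (compl_rel E) z j i"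

lemma zh: "hubs V (compl_rel E) z j i"
proof -
  interpret c: extremal_config V "compl_rel E" z "\<lambda>v. - x v" k l j i by (rule rot)
  show ?thesis by (rule c.xh.hubs_axioms)
qed

lemma za:
  "z k * card (R - Q) + (\<Sum>v\<in>P - R. max (z v) 0) + (\<Sum>v\<in>B. max (z v) 0)
     + zleak + z i * card zlows - z j * card zhighs \<le> - z l + (\<Sum>v\<in>P. max (- z v) 0)"
proof -
  have B: "V - {k, l, j, i} - R - S - Q - P = B" by blast
  show ?thesis using extremal_config.xa[OF rot] by (simp add: compl_compl B del: mem_nb mem_conb)
qed

lemma zb:
  "- z l * card (S - P) + (\<Sum>v\<in>Q - S. max (- z v) 0) + (\<Sum>v\<in>B. max (- z v) 0)
     + zleak + z i * card zlows - z j * card zhighs \<le> z k + (\<Sum>v\<in>Q. max (z v) 0)"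
proof -
  have B: "V - {k, l, j, i} - R - S - Q - P = B" by blast
  show ?thesis using extremal_config.xb[OF rot] by (simp add: compl_compl B del: mem_nb mem_conb)
qed

lemma sum_z_nb: "v \<in> V \<Longrightarrow> (\<Sum>w\<in>nb v. z w) = - real (card (conb v)) * z v"
proof -
  interpret zh: hubs V "compl_rel E" z j i by (rule zh)
  show "v \<in> V \<Longrightarrow> ?thesis" using zh.sum_conb[of v] by (simp add: compl_compl)
qed

lemma mem_zcut: "(u, w) \<in> zcut \<longleftrightarrow> u \<in> V \<and> u \<noteq> i \<and> u \<noteq> j \<and> w \<in> V \<and> w \<noteq> i \<and> w \<noteq> j
    \<and> u \<noteq> w \<and> \<not> E u w \<and> 0 < z u \<and> z w \<le> 0"
  using hubs.mem_cut[OF zh] by (auto simp: compl_rel_def)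

lemma mem_zlows: "v \<in> zlows \<longleftrightarrow> v \<in> V \<and> v \<noteq> i \<and> v \<noteq> j \<and> \<not> E v i \<and> z v \<le> 0"
  using hubs.mem_lows[OF zh] by (auto simp: compl_rel_def)

lemma mem_zhighs: "v \<in> zhighs \<longleftrightarrow> v \<in> V \<and> v \<noteq> i \<and> v \<noteq> j \<and> \<not> E v j \<and> 0 < z v"
  using hubs.mem_highs[OF zh] by (auto simp: compl_rel_def)

lemma ge_mult_card:
  assumes "finite T" "v \<in> T" "0 \<le> a"
  shows "a \<le> a * real (card T)"
proof -
  have "1 \<le> card T" using assms by (auto simp: Suc_le_eq card_gt_0_iff)
  then show ?thesis using mult_left_mono[of 1 "real (card T)" a] assms(3) by simp
qed

lemma cells: 
  "p \<in> P \<Longrightarrow> p \<in> V \<and> p \<noteq> i \<and> p \<noteq> j \<and> p \<noteq> k \<and> p \<noteq> l \<and> E i p \<and> E p i \<and> \<not> E p j \<and> \<not> E j p \<and> 0 < x p"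
  "r \<in> R \<Longrightarrow> r \<in> V \<and> r \<noteq> i \<and> r \<noteq> j \<and> r \<noteq> k \<and> r \<noteq> l \<and> \<not> E r k \<and> \<not> E k r \<and> E l r \<and> E r l \<and> 0 < z r"
  "q \<in> Q \<Longrightarrow> q \<in> V \<and> q \<noteq> i \<and> q \<noteq> j \<and> q \<noteq> k \<and> q \<noteq> l \<and> E q j \<and> E j q \<and> \<not> E i q \<and> \<not> E q i \<and> x q < 0"
  "s \<in> S \<Longrightarrow> s \<in> V \<and> s \<noteq> i \<and> s \<noteq> j \<and> s \<noteq> k \<and> s \<noteq> l \<and> \<not> E l s \<and> \<not> E s l \<and> E k s \<and> E s k \<and> z s < 0"
  "b \<in> B \<Longrightarrow> b \<in> V \<and> b \<noteq> i \<and> b \<noteq> j \<and> b \<noteq> k \<and> b \<noteq> l \<and> \<not> E i b \<and> \<not> E b i \<and> \<not> E j b \<and> \<not> E b j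
     \<and> E k b \<and> E b k \<and> E l b \<and> E b l"
proof -
  have o: "v \<in> V \<and> v \<noteq> i \<and> v \<noteq> j \<and> v \<noteq> k \<and> v \<noteq> l" if "v \<in> P \<or> v \<in> Q \<or> v \<in> R \<or> v \<in> S" for v
    using subsetD[OF outs, of v] that by blast
  show "p \<in> P \<Longrightarrow> p \<in> V \<and> p \<noteq> i \<and> p \<noteq> j \<and> p \<noteq> k \<and> p \<noteq> l \<and> E i p \<and> E p i \<and> \<not> E p j \<and> \<not> E j p \<and> 0 < x p"
    using o[of p] P_pos[of p] disj[of p] sym by (meson DiffD1 mem_nb)
  show "q \<in> Q \<Longrightarrow> q \<in> V \<and> q \<noteq> i \<and> q \<noteq> j \<and> q \<noteq> k \<and> q \<noteq> l \<and> E q j \<and> E j q \<and> \<not> E i q \<and> \<not> E q i \<and> x q < 0"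
    using o[of q] Q_neg[of q] disj[of q] sym by (meson DiffD1 mem_nb)
  show "r \<in> R \<Longrightarrow> r \<in> V \<and> r \<noteq> i \<and> r \<noteq> j \<and> r \<noteq> k \<and> r \<noteq> l \<and> \<not> E r k \<and> \<not> E k r \<and> E l r \<and> E r l \<and> 0 < z r"
    using o[of r] R_pos[of r] dom[of r] sym by (meson DiffD1 mem_conb)
  show "s \<in> S \<Longrightarrow> s \<in> V \<and> s \<noteq> i \<and> s \<noteq> j \<and> s \<noteq> k \<and> s \<noteq> l \<and> \<not> E l s \<and> \<not> E s l \<and> E k s \<and> E s k \<and> z s < 0"
    using o[of s] S_neg[of s] dom[of s] sym by (meson DiffD1 mem_conb)
  show "b \<in> B \<Longrightarrow> b \<in> V \<and> b \<noteq> i \<and> b \<noteq> j \<and> b \<noteq> k \<and> b \<noteq> l \<and> \<not> E i b \<and> \<not> E b i \<and> \<not> E j b \<and> \<not> E b j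
     \<and> E k b \<and> E b k \<and> E l b \<and> E b l"
    using sym by auto
qed

lemma cell_cases:
  assumes "v \<in> V" "v \<noteq> i" "v \<noteq> j" "v \<noteq> k" "v \<noteq> l"
  obtains "v \<in> P" | "v \<in> Q" | "v \<in> R" | "v \<in> S" | "v \<in> B"
  using assms by blast

lemma not_P: "v \<in> V \<Longrightarrow> v \<noteq> l \<Longrightarrow> v \<notin> P \<Longrightarrow> \<not> E v i" 
  and not_Q: "v \<in> V \<Longrightarrow> v \<noteq> k \<Longrightarrow> v \<notin> Q \<Longrightarrow> \<not> E v j"
  and not_R: "v \<in> V \<Longrightarrow> v \<noteq> k \<Longrightarrow> v \<noteq> i \<Longrightarrow> v \<notin> R \<Longrightarrow> E v k"
  and not_S: "v \<in> V \<Longrightarrow> v \<noteq> l \<Longrightarrow> v \<noteq> j \<Longrightarrow> v \<notin> S \<Longrightarrow> E v l"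
  using sym by auto

lemma fin_cells [simp]: "finite P" "finite Q" "finite R" "finite S" "finite B"
  using finV by auto

lemma max_sum_nonneg: "0 \<le> (\<Sum>v\<in>T. max (f v) (0::real))"
  by (intro sum_nonneg) auto

lemma max_sum_mem: "finite T \<Longrightarrow> v \<in> T \<Longrightarrow> f v \<le> (\<Sum>v\<in>T. max (f v) (0::real))"
  using member_le_sum[of v T "\<lambda>v. max (f v) 0"] by fastforce

lemma max_sum_eq_0: "(\<And>v. v \<in> T \<Longrightarrow> f v \<le> 0) \<Longrightarrow> (\<Sum>v\<in>T. max (f v) (0::real)) = 0"
  by (intro sum.neutral) auto

lemma max_sum_filter: "finite T \<Longrightarrow> (\<Sum>v\<in>T. max (f v) (0::real)) = (\<Sum>v\<in>{v\<in>T. 0 < f v}. f v)"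
  by (auto simp: sum.inter_filter max_def intro!: sum.cong)

lemma max_sum_filter': "finite T \<Longrightarrow> (\<Sum>v\<in>T. max (f v) (0::real)) = (\<Sum>v\<in>{v\<in>T. 0 \<le> f v}. f v)"
  by (auto simp: sum.inter_filter max_def intro!: sum.cong)

lemma nonneg_terms:
  "0 \<le> xh.leak" "0 \<le> x l * card xh.lows" "0 \<le> - x k * card xh.highs"
  "0 \<le> zleak" "0 \<le> z i * card zlows" "0 \<le> - z j * card zhighs"
  "0 \<le> x i * card T" "0 \<le> - x j * card T"
  using xh.leak_nonneg hubs.leak_nonneg[OF zh] x_l x_k z_i z_j x_i x_j
  by (auto simp: mult_nonneg_nonneg mult_nonpos_nonneg)

text \<open>The terms of the equation at the maximum \<open>p\<close> belonging to \<open>k\<close>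
  and \<open>l\<close> would give \<open>x i \<le> x k + x l\<close>, against
  \<open>x k \<le> 0\<close> and \<open>x l < x i\<close>.\<close>

lemma top_not_adj:
  assumes "p \<in> V" "x p = x i" "E p k" "E p l"
  shows False
proof -
  have "(\<Sum>w\<in>{k, l}. x p - x w) \<le> (\<Sum>w\<in>nb p. x p - x w)"
    using assms kV lV x_le by (intro sum_mono2) auto
  moreover have "k \<noteq> l" using kl irr by auto
  ultimately have "(x p - x k) + (x p - x l) \<le> x p"
    using eigx[OF assms(1)] by (simp add: lapl_def)
  then show False using assms(2) x_l_less x_k by linarith
qed

text \<open>A single member of \<open>lows\<close> already puts a full \<open>x l\<close> on the
  left of \<open>xa\<close> and \<open>xb\<close>; the next three lemmas do the same for the other
  counting terms.\<close>

lemma xlowI: "v \<in> V \<Longrightarrow> v \<noteq> k \<Longrightarrow> v \<noteq> l \<Longrightarrow> E v l \<Longrightarrow> x v \<le> 0 \<Longrightarrow> x l \<le> x l * card xh.lows"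
  using xh.finite_lows x_l by (intro ge_mult_card) (auto simp: xh.mem_lows)

lemma xhighI: "v \<in> V \<Longrightarrow> v \<noteq> k \<Longrightarrow> v \<noteq> l \<Longrightarrow> E v k \<Longrightarrow> 0 < x v \<Longrightarrow> - x k \<le> - x k * card xh.highs"
  using xh.finite_highs x_k by (intro ge_mult_card) (auto simp: xh.mem_highs)

lemma zlowI: "v \<in> V \<Longrightarrow> v \<noteq> i \<Longrightarrow> v \<noteq> j \<Longrightarrow> \<not> E v i \<Longrightarrow> z v \<le> 0 \<Longrightarrow> z i \<le> z i * card zlows"
  using hubs.finite_lows[OF zh] z_i by (intro ge_mult_card) (auto simp: mem_zlows)

lemma zhighI: "v \<in> V \<Longrightarrow> v \<noteq> i \<Longrightarrow> v \<noteq> j \<Longrightarrow> \<not> E v j \<Longrightarrow> 0 < z v \<Longrightarrow> - z j \<le> - z j * card zhighs"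
  using hubs.finite_highs[OF zh] z_j by (intro ge_mult_card) (auto simp: mem_zhighs)

lemma P_top: "x l = 0 \<Longrightarrow> p \<in> P \<Longrightarrow> x p = x i"
  using P_ge[of p] x_le[of p] cells(1)[of p] by fastforce

text \<open>
  If \<open>R \<subseteq> Q\<close>, then \<open>x < 0\<close> on \<open>R\<close>, and \<open>xb\<close> leaves no room for an edge from \<open>P\<close> to a vertex with
  \<open>x \<le> 0\<close>. The resulting non-edges all contribute to the leak of \<open>z\<close>, which \<open>za\<close> bounds.
\<close>

lemma R_not_subset_Q: "\<not> R \<subseteq> Q"
proof
  assume RQ: "R \<subseteq> Q"
  have RP: "R \<inter> P = {}" using RQ PQ by blast
  obtain q where q: "q \<in> R" "q \<in> Q" using R_ne RQ by blast
  note cq = cells(2)[OF q(1)] cells(3)[OF q(2)]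
  have PR: "P - R = P" using RP by blast
  have RQ0: "R - Q = {}" using RQ by blast
  have al: "x l \<le> x l * card xh.lows" using cq by (intro xlowI[of q]) auto
  have QS: "- x j \<le> - x j * card (Q - S)"
    using q RS x_j by (intro ge_mult_card[of _ q]) auto
  have "(\<Sum>v\<in>R. max (x v) 0) = 0"
    using RQ cells(3) by (intro max_sum_eq_0 less_imp_le) blast
  then have xb': "- x j * card (Q - S) + (\<Sum>v\<in>B. max (- x v) 0)
     + xh.leak + x l * card xh.lows - x k * card xh.highs \<le> x i"
    using xb RQ0 by simp
  have xa': "x i * card P + (\<Sum>v\<in>S - P. max (x v) 0) + (\<Sum>v\<in>B. max (x v) 0)
     + xh.leak + x l * card xh.lows - x k * card xh.highs \<le> - x j + (\<Sum>v\<in>S. max (- x v) 0)"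
    using xa unfolding PR .
  have za': "(\<Sum>v\<in>P. max (z v) 0) + (\<Sum>v\<in>B. max (z v) 0)
     + zleak + z i * card zlows - z j * card zhighs \<le> - z l + (\<Sum>v\<in>P. max (- z v) 0)"
    using za unfolding PR RQ0 by simp
  \<comment> \<open>Such an edge leaks at least \<open>x i - x l\<close>. As \<open>q\<close>
    contributes \<open>x l\<close> through \<open>lows\<close> and \<open>- x j\<close> through
    \<open>Q - S\<close>, the left side of \<open>xb'\<close> would exceed
    \<open>x i\<close>.\<close>
  have A1: "\<not> E p v" if p: "p \<in> P" and v: "v \<in> V" "v \<noteq> k" "v \<noteq> l" "x v \<le> 0" for p v
  proof
    assume "E p v"
    then have "(p, v) \<in> xh.cut" using cells(1)[OF p] v by (simp add: xh.mem_cut)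
    then have "x p - x v \<le> xh.leak" by (rule xh.leak_one)
    then have "x i - x l \<le> xh.leak" using P_ge[OF p] v by linarith
    then show False
      using xb' al QS max_sum_nonneg[of "\<lambda>v. - x v" B] nonneg_terms(3) x_j by linarith
  qed
  define Pn where "Pn = {p \<in> P. z p \<le> 0}"
  have "Pn \<subseteq> P" by (auto simp: Pn_def)
  then have finPn: "finite Pn" "Pn \<subseteq> P" using finite_subset[OF _ fin_cells(1)] by blast+
  show False
  proof (cases "Pn = {}")
    case True
    have zp: "0 < z p" if "p \<in> P" for p using True that unfolding Pn_def by force
    obtain p where p: "p \<in> P" using P_ne by blast
    have zP: "(\<Sum>v\<in>P. max (- z v) 0) = 0"
      using zp by (intro max_sum_eq_0) (simp add: less_imp_le)
    show False
    proof (cases "\<exists>s\<in>S. x s < 0")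
      case True
      then obtain s where s: "s \<in> S" "x s < 0" by blast
      note cs = cells(4)[OF s(1)] and cp = cells(1)[OF p]
      have "\<not> E p s" using A1[OF p, of s] cs s by auto
      then have "(p, s) \<in> zcut" using cs cp zp[OF p] s by (auto simp: mem_zcut)
      then have "z p - z s \<le> zleak" by (rule hubs.leak_one[OF zh])
      moreover have "- z j \<le> - z j * card zhighs" using cp zp[OF p] by (intro zhighI[of p]) auto
      ultimately show False
        using za' zP S_le[OF s(1)] zp[OF p] nonneg_terms(5)
          max_sum_nonneg[of z P] max_sum_nonneg[of z B] by linarith
    next
      case False
      \<comment> \<open>Now \<open>xa'\<close> is tight, so \<open>x l = 0\<close> and
        \<open>p\<close> is a maximum of \<open>x\<close>. Lying in neither \<open>R\<close> nor
        \<open>S\<close>, it is adjacent to both hubs, against \<open>top_not_adj\<close>.\<close>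
      then have xS: "(\<Sum>v\<in>S. max (- x v) 0) = 0"
        by (intro max_sum_eq_0) force
      have "x i \<le> x i * card P" using p x_i by (intro ge_mult_card) auto
      then have "x l = 0"
        using xa' xS al x_l x_ord xh.leak_nonneg nonneg_terms(3)
          max_sum_nonneg[of x B] max_sum_nonneg[of x "S - P"] by linarith
      then have "x p = x i" using p by (rule P_top)
      moreover have "p \<notin> S" using zp[OF p] cells(4)[of p] by force
      moreover have "p \<notin> R" using p RP by blast
      ultimately show False using top_not_adj[of p] cells(1)[OF p] not_R[of p] not_S[of p] by blast
    qed
  next
    case False
    have pi1: "1 \<le> card Pn" using False finPn(1) by (simp add: Suc_leI card_gt_0_iff)
    have pq: "\<not> E p q" if "p \<in> P" for p using A1[OF that, of q] cq by auto
    have qcut: "(q, p) \<in> zcut" if "p \<in> Pn" for p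
    proof -
      have "p \<in> P" "z p \<le> 0" using that by (auto simp: Pn_def)
      moreover have "\<not> E q p" using pq[OF \<open>p \<in> P\<close>] sym by blast
      moreover have "q \<noteq> p" using \<open>p \<in> P\<close> RP q by blast
      ultimately show ?thesis using cells(1)[OF \<open>p \<in> P\<close>] cq unfolding mem_zcut by blast
    qed
    have zPn: "(\<Sum>v\<in>P. max (- z v) 0) = (\<Sum>p\<in>Pn. - z p)"
      by (subst max_sum_filter') (simp_all add: Pn_def)
    have "(\<Sum>p\<in>Pn. z q - z p) \<le> zleak"
      using qcut finPn by (intro hubs.leak_down[OF zh]) (auto simp: Pn_def)
    then have "card Pn * z q + (\<Sum>p\<in>Pn. - z p) \<le> zleak" by (simp add: sum_subtractf sum_negf)
    then have st: "card Pn * z q + (\<Sum>v\<in>P. max (z v) 0) + (\<Sum>v\<in>B. max (z v) 0)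
        + z i * card zlows - z j * card zhighs \<le> - z l"
      using za' zPn by linarith
    have "card Pn * (z k - z i) \<le> card Pn * z q"
      using R_ge[OF q(1)] by (intro mult_left_mono) auto
    then have st': "card Pn * (z k - z i) + (\<Sum>v\<in>P. max (z v) 0) + (\<Sum>v\<in>B. max (z v) 0)
        + z i * card zlows - z j * card zhighs \<le> z k"
      using st z_ord by linarith
    show False
    \<comment> \<open>In the first case the left side of \<open>st'\<close> is at least
      \<open>z k\<close>, so all its slack vanishes. In the second case it is \<open>xa'\<close>
      that becomes tight.\<close>
    proof (cases "card Pn \<le> card zlows")
      case True
      have e1: "card Pn * (z k - z i) + z i * card zlows
          = z k + (real (card Pn) - 1) * z k + z i * (real (card zlows) - real (card Pn))"
        by (simp add: algebra_simps)
      have "0 \<le> (real (card Pn) - 1) * z k" "0 \<le> z i * (real (card zlows) - real (card Pn))"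
        using pi1 z_k True z_i by auto
      then have zero: "(real (card Pn) - 1) * z k = 0" "z i * (real (card zlows) - real (card Pn)) = 0"
        "(\<Sum>v\<in>P. max (z v) 0) = 0" "(\<Sum>v\<in>B. max (z v) 0) = 0"
        using st' e1 nonneg_terms(6) max_sum_nonneg[of z P] max_sum_nonneg[of z B] by linarith+
      then have c1: "card Pn = 1" using z_k by simp
      have "z v \<le> 0" if "v \<in> P" for v using zero(3) max_sum_mem[OF fin_cells(1) that, of z] by simp
      then have "Pn = P" by (auto simp: Pn_def)
      with c1 obtain p where p: "P = {p}" by (auto simp: card_1_singleton_iff)
      have pP: "p \<in> P" unfolding p by simp
      have pPn: "p \<in> Pn" using pP \<open>Pn = P\<close> by simp
      have zp: "z p \<le> 0" using pPn by (simp add: Pn_def)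
      note cp = cells(1)[OF pP]
      have "z i \<noteq> 0"
      proof
        assume "z i = 0"
        then have "(\<Sum>w\<in>nb i. z w) = 0" using sum_z_nb[OF iV] by simp
        moreover have "(\<Sum>w\<in>nb i. z w) = z l + (\<Sum>w\<in>P. z w)"
          using il lV by (intro sum.remove) auto
        ultimately have "z p = - z l" unfolding p by simp
        then show False using zp z_l by linarith
      qed
      then have m1: "card zlows = 1" using zero(2) c1 by simp
      \<comment> \<open>At least two vertices remain besides the six named ones, and none of them is
        adjacent to \<open>i\<close>. As \<open>zlows\<close> is a singleton, one of them has
        positive \<open>z\<close>; it lies in \<open>Q\<close>, is not adjacent to \<open>p\<close>,
        and its leak is too much for \<open>za'\<close>.\<close>
      define T where "T = V - {i, j, k, l, p, q}"
      have "card {i, j, k, l, p, q} \<le> 6" by (simp add: card_insert_if)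
      moreover have "card V - card {i, j, k, l, p, q} \<le> card T"
        unfolding T_def by (rule diff_card_le_card_Diff) simp
      ultimately have "2 \<le> card T" using card_V by linarith
      have "\<exists>v\<in>T. 0 < z v"
      proof (rule ccontr)
        assume "\<not> (\<exists>v\<in>T. 0 < z v)"
        moreover have "v \<in> V \<and> v \<noteq> i \<and> v \<noteq> j \<and> \<not> E v i" if "v \<in> T" for v
        proof -
          have "v \<in> V" "v \<noteq> l" "v \<notin> {p}" "v \<noteq> i" "v \<noteq> j" using that by (auto simp: T_def)
          then show ?thesis using not_P[of v] unfolding p by blast
        qed
        ultimately have "T \<subseteq> zlows" unfolding mem_zlows subset_iff using not_less by blast
        then have "card T \<le> card zlows" by (rule card_mono[OF hubs.finite_lows[OF zh]])
        then show False using m1 \<open>2 \<le> card T\<close> by linarith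
      qed
      then obtain v where v: "v \<in> T" "0 < z v" by blast
      then have vV: "v \<in> V" "v \<noteq> i" "v \<noteq> j" "v \<noteq> k" "v \<noteq> l" "v \<noteq> p" "v \<noteq> q" by (auto simp: T_def)
      have "v \<notin> B" using zero(4) max_sum_mem[OF fin_cells(5), of v z] v(2) by linarith
      moreover have "v \<notin> S" using cells(4)[of v] v(2) less_asym by blast
      moreover have "v \<notin> P" using vV unfolding p by blast
      ultimately have "v \<in> Q" using cell_cases[of v] vV RQ by blast
      then have "\<not> E p v" using A1[OF pP, of v] cells(3)[OF \<open>v \<in> Q\<close>] less_imp_le by blast
      then have "(v, p) \<in> zcut" using vV v zp cp sym by (auto simp: mem_zcut)
      then have "(\<Sum>w\<in>{p}. z q - z w) + (\<Sum>w\<in>{p}. z v - z w) \<le> zleak"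
        using qcut[OF pPn] vV by (intro hubs.leak_two_down[OF zh]) auto
      then have "z q - z p + (z v - z p) + z i \<le> - z l - z p"
        using za' zPn m1 nonneg_terms(6) zero(3,4) unfolding \<open>Pn = P\<close> p by simp
      then show False using R_ge[OF q(1)] z_ord v zp by linarith
    next
      case False
      then have mm: "card zlows + 1 \<le> card Pn" by simp
      \<comment> \<open>Only \<open>Sn\<close> contributes to the right side of \<open>xa'\<close>,
        and it embeds into \<open>zlows\<close>. Hence \<open>x i * card P\<close> lies below a
        chain of bounds that ends in \<open>x i * card P\<close> itself, and all of them are
        equalities.\<close>
      define Sn where "Sn = {s \<in> S. x s < 0}"
      have cPn: "card Pn \<le> card P" using finPn by (intro card_mono) auto
      have S_low: "s \<in> zlows" if "s \<in> S - P" for s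
      proof -
        have "s \<in> S" "s \<notin> P" using that by auto
        then show ?thesis using cells(4)[OF \<open>s \<in> S\<close>] not_P[OF _ _ \<open>s \<notin> P\<close>] less_imp_le unfolding mem_zlows by blast
      qed
      have Sn_sub: "Sn \<subseteq> S - P" using cells(1) by (force simp: Sn_def)
      have SP: "card (S - P) \<le> card zlows"
        using S_low by (intro card_mono hubs.finite_lows[OF zh]) blast
      have "card Sn \<le> card (S - P)" using Sn_sub by (intro card_mono) auto
      have "(\<Sum>v\<in>S. max (- x v) 0) = (\<Sum>v\<in>Sn. - x v)"
        by (subst max_sum_filter) (simp_all add: Sn_def)
      also have "\<dots> \<le> (\<Sum>v\<in>Sn. - x j)" by (intro sum_mono) (auto simp: Sn_def x_ge)
      also have "\<dots> = - x j * card Sn" by simp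
      also have "\<dots> \<le> - x j * card zlows"
        using SP \<open>card Sn \<le> card (S - P)\<close> x_j by (intro mult_left_mono) auto
      finally have SY: "- x j + (\<Sum>v\<in>S. max (- x v) 0) \<le> - x j * (real (card zlows) + 1)"
        by (simp add: algebra_simps)
      also have m2: "\<dots> \<le> x i * (real (card zlows) + 1)"
        using x_ord by (intro mult_right_mono) auto
      also have m3: "\<dots> \<le> x i * card Pn" using mm x_i by (intro mult_left_mono) auto
      also have m4: "\<dots> \<le> x i * card P" using cPn x_i by (intro mult_left_mono) auto
      finally have tight: "x i * card P = x i * card Pn" "x i * card Pn = x i * (real (card zlows) + 1)"
        "x i * (real (card zlows) + 1) = - x j * (real (card zlows) + 1)"
        "xh.leak = 0" "x l = 0" "(\<Sum>v\<in>B. max (x v) 0) = 0"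
        using xa' al SY m2 m3 m4 x_l xh.leak_nonneg nonneg_terms(3)
          max_sum_nonneg[of x B] max_sum_nonneg[of x "S - P"] by linarith+
      have "real (card zlows) + 1 \<noteq> 0" by linarith
      then have XY: "x i = - x j" using tight(3) mult_right_cancel by blast
      have cP: "card P = card zlows + 1" "card Pn = card zlows + 1" using tight(1,2) x_i by auto
      \<comment> \<open>Since \<open>x l = 0\<close>, all of \<open>P\<close> is maximal for
        \<open>x\<close>; a vertex of \<open>P\<close> outside \<open>S\<close> would be adjacent to
        both hubs.\<close>
      have PS: "P \<subseteq> S"
      proof
        fix p assume p: "p \<in> P"
        show "p \<in> S"
        proof (rule ccontr)
          assume "p \<notin> S"
          moreover have "p \<notin> R" using p RP by blast
          ultimately show False
            using P_top[OF tight(5) p] top_not_adj[of p] cells(1)[OF p] not_R[of p] not_S[of p] by blast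
        qed
      qed
      have "- x j * card (Q - S) = x i * card (Q - S)" by (simp only: XY)
      then have "x i * card (Q - S) \<le> x i"
        and xB: "(\<Sum>v\<in>B. max (- x v) 0) = 0"
        using xb' QS XY nonneg_terms(2) nonneg_terms(3) xh.leak_nonneg max_sum_nonneg[of "\<lambda>v. - x v" B]
        by linarith+
      then have QS1: "card (Q - S) \<le> 1" using x_i by simp
      have xB0: "x v = 0" if "v \<in> B" for v
        using max_sum_mem[OF fin_cells(5) that, of x] max_sum_mem[OF fin_cells(5) that, of "\<lambda>v. - x v"]
          xB tight(6) by simp
      show False
      proof (cases "card zlows = 0")
        case False
        have "card Pn * (z k - z i) + z i * card zlows \<le> z k"
          using st' nonneg_terms(6) max_sum_nonneg[of z P] max_sum_nonneg[of z B] by linarith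
        then have "(real (card zlows) + 1) * (z k - z i) + z i * card zlows \<le> z k"
          unfolding cP(2) by (simp add: add.commute)
        then have "card zlows * z k \<le> z i" by (simp add: algebra_simps)
        moreover have "1 * z k \<le> card zlows * z k" using False z_k by (intro mult_right_mono) auto
        ultimately show False using z_i_less by linarith
      next
        case True
        then obtain p where p: "P = {p}" using cP by (auto simp: card_1_singleton_iff)
        have pP: "p \<in> P" unfolding p by simp
        have "Pn = P" using \<open>Pn \<noteq> {}\<close> finPn(2) unfolding p by blast
        have "S - P = {}" using SP True by (metis card_0_eq finite_Diff fin_cells(4) le_zero_eq)
        then have S: "S = {p}" using PS unfolding p by blast
        have "Q - S = {q}"
        proof -
          have "q \<in> Q - S" using q RS by blast
          moreover have "\<forall>v\<in>Q - S. \<forall>w\<in>Q - S. v = w"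
            using QS1 by (subst (asm) One_nat_def, subst (asm) card_le_Suc0_iff_eq) (rule finite_Diff, rule fin_cells(2))
          ultimately show ?thesis by blast
        qed
        moreover have "Q \<inter> S = {}" using PQ unfolding S p by blast
        ultimately have "Q = {q}" by blast
        \<comment> \<open>All cells but \<open>B\<close> consist of \<open>p\<close> and
          \<open>q\<close>. A vertex of \<open>B\<close> has \<open>x\<close> zero and,
          \<open>zlows\<close> being empty, positive \<open>z\<close>; by \<open>A1\<close> it is a
          second source of leak into \<open>p\<close>.\<close>
        have "B \<noteq> {}"
        proof
          assume "B = {}"
          then have "V \<subseteq> {i, j, k, l, p, q}" using p S \<open>Q = {q}\<close> RQ by blast
          then have "card V \<le> card {i, j, k, l, p, q}" by (intro card_mono) auto
          also have "\<dots> \<le> 6" by (simp add: card_insert_if)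
          finally show False using card_V by simp
        qed
        then obtain v where v: "v \<in> B" by blast
        note cv = cells(5)[OF v] and cp = cells(1)[OF pP]
        have zl: "zlows = {}" using True hubs.finite_lows[OF zh] by simp
        have zv: "0 < z v"
        proof (rule ccontr)
          assume "\<not> 0 < z v"
          then have "v \<in> zlows" using cv by (simp add: mem_zlows)
          then show False using zl by simp
        qed
        have pPn: "p \<in> Pn" using pP \<open>Pn = P\<close> by simp
        have zp: "z p \<le> 0" using pPn by (simp add: Pn_def)
        have "\<not> E p v" using A1[OF pP, of v] cv xB0[OF v] by auto
        moreover have "v \<noteq> p" using v pP by blast
        ultimately have "(v, p) \<in> zcut" using cv zv zp cp sym by (auto simp: mem_zcut)
        moreover have "v \<noteq> q" using v q by blast
        ultimately have "(\<Sum>w\<in>{p}. z q - z w) + (\<Sum>w\<in>{p}. z v - z w) \<le> zleak"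
          using qcut[OF pPn] by (intro hubs.leak_two_down[OF zh]) auto
        then have "z q - z p + (z v - z p) - z j * card zhighs \<le> - z l - z p"
          using za' zPn nonneg_terms(5) max_sum_nonneg[of z P] max_sum_nonneg[of z B]
          unfolding \<open>Pn = P\<close> p by simp
        moreover have "- z j \<le> - z j * card zhighs" using cv zv by (intro zhighI[of v]) auto
        moreover have "p \<in> S" unfolding S by blast
        note S_le[OF this]
        ultimately show False using zv cq by linarith
      qed
    qed
  qed
qed

section \<open>The sign of \<open>z\<close> on \<open>P\<close>\<close>

lemma sum_S_sub: "T \<subseteq> S \<Longrightarrow> - z l * card T \<le> - z j + (\<Sum>v\<in>T. - z v)"
  by (rule extremal_config.sum_P_sub[OF rot3])

lemma finite_cell_filter [simp]:
  "finite {v \<in> P. f v}" "finite {v \<in> Q. f v}" "finite {v \<in> R. f v}" "finite {v \<in> S. f v}"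
  using finV by simp_all

text \<open>The idea is that each suitable pair is either an edge, and leaks for \<open>x\<close>,
  or a non-edge, and leaks for \<open>z\<close>. With witnesses \<open>r\<close> in \<open>R\<close>
  and \<open>v\<close> in \<open>Q\<close>, counting the pairs \<open>(r, s)\<close> and
  \<open>(v, p)\<close> on both sides gives incompatible cardinalities.\<close>

lemma z_P_nonneg: "\<forall>p\<in>P. 0 \<le> z p"
proof (rule ccontr)
  assume neg: "\<not> (\<forall>p\<in>P. 0 \<le> z p)"
  define Pm where "Pm = {p \<in> P. z p < 0}"
  define Sm where "Sm = {s \<in> S. x s < 0}"
  have fin: "finite Pm" "finite Sm" unfolding Pm_def Sm_def by (rule finite_cell_filter)+
  have Pm: "p \<in> P \<and> z p < 0 \<and> p \<notin> R" if "p \<in> Pm" for p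
    using that cells(2)[of p] less_asym unfolding Pm_def by blast
  have Sm: "s \<in> S \<and> x s < 0 \<and> s \<notin> P" if "s \<in> Sm" for s
    using that cells(1)[of s] less_asym unfolding Sm_def by blast
  have zP: "(\<Sum>v\<in>P. max (- z v) 0) = (\<Sum>p\<in>Pm. - z p)"
    unfolding Pm_def by (subst max_sum_filter[OF fin_cells(1)]) (simp only: neg_0_less_iff_less)
  have xS: "(\<Sum>v\<in>S. max (- x v) 0) = (\<Sum>s\<in>Sm. - x s)"
    unfolding Sm_def by (subst max_sum_filter[OF fin_cells(4)]) (simp only: neg_0_less_iff_less)
  obtain p0 where p0: "p0 \<in> Pm" using neg unfolding Pm_def by force
  note p0' = Pm[OF p0]
  have "card Pm \<noteq> 0" using p0 fin(1) by auto
  then have Pm1: "1 \<le> card Pm" by simp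
  obtain r0 where r0: "r0 \<in> R - Q" using R_not_subset_Q by blast
  have RQ: "z k \<le> z k * card (R - Q)"
    using r0 z_k by (intro ge_mult_card[of _ r0] finite_Diff fin_cells) auto
  have "card Pm \<le> card (P - R)"
    using Pm by (intro card_mono finite_Diff fin_cells) blast
  then have PR: "x i * card Pm \<le> x i * card (P - R)" 
    using x_i by (intro mult_left_mono) auto
  have "x i * 1 \<le> x i * card Pm" using Pm1 x_i by (intro mult_left_mono) auto
  then have PR1: "x i \<le> x i * card (P - R)" using PR by simp
  \<comment> \<open>Otherwise all pairs from \<open>r\<close> to \<open>Pm\<close> leak for
    \<open>z\<close>; this cancels the negative part of \<open>z\<close> on \<open>P\<close> in
    \<open>za\<close> and leaves \<open>z k + z r \<le> - z l\<close>.\<close>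
  have no_adj: "\<exists>p\<in>Pm. E p r" if r: "r \<in> R" for r
  proof (rule ccontr)
    assume na: "\<not> (\<exists>p\<in>Pm. E p r)"
    have "(r, p) \<in> zcut" if "p \<in> Pm" for p
      using cells(2)[OF r] cells(1)[of p] Pm[OF that] na that sym[of r p] r less_imp_le
      unfolding mem_zcut by blast
    then have "(\<Sum>p\<in>Pm. z r - z p) \<le> zleak"
      using fin by (intro hubs.leak_down[OF zh])
    then have "card Pm * z r + (\<Sum>p\<in>Pm. - z p) \<le> zleak" by (simp add: sum_subtractf sum_negf)
    moreover have "1 * z r \<le> card Pm * z r"
      using Pm1 cells(2)[OF r] by (intro mult_right_mono) auto
    ultimately show False
      using za zP RQ cells(2)[OF r] z_ord nonneg_terms(5,6) max_sum_nonneg[of z "P - R"] max_sum_nonneg[of z B]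
      by linarith
  qed
  have sumR: "(\<Sum>v\<in>conb k. x v) = x i + (\<Sum>v\<in>R. x v)"
    using iV ik neq sym by (intro sum.remove) auto
  \<comment> \<open>If not, an edge from \<open>Pm\<close> to \<open>r0\<close> makes
    \<open>xb\<close> tight. Then \<open>x\<close> vanishes at \<open>k\<close> and on
    \<open>R\<close>, and the sum of \<open>x\<close> over the non-neighbours of \<open>k\<close> is
    \<open>x i\<close> although \<open>sum_conb\<close> makes it zero.\<close>
  have "\<exists>r\<in>R. 0 < x r"
  proof (rule ccontr)
    assume Rp: "\<not> (\<exists>r\<in>R. 0 < x r)"
    then have Rle: "x r \<le> 0" if "r \<in> R" for r using that not_less by blast
    have "(\<Sum>v\<in>R. max (x v) 0) = 0" using Rle by (rule max_sum_eq_0)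
    note xb' = xb[unfolded this]
    obtain p where p: "p \<in> Pm" "E p r0" using no_adj r0 by blast
    note p' = Pm[OF p(1)]
    note cp = cells(1)[OF conjunct1[OF p']]
    have r0R: "r0 \<in> R" using r0 by blast
    note cr = cells(2)[OF r0R]
    have "(p, r0) \<in> xh.cut" using cp cr p(2) Rle[OF r0R] unfolding xh.mem_cut by blast
    then have "x p - x r0 \<le> xh.leak" by (rule xh.leak_one)
    moreover have "x i - x l \<le> x p" using p' by (intro P_ge) blast
    moreover have "x l \<le> x l * card xh.lows" using cr Rle[OF r0R] by (intro xlowI[of r0]) auto
    moreover have "E p k" using p' cp by (intro not_R) blast+
    then have "- x k \<le> - x k * card xh.highs" using cp by (intro xhighI[of p]) auto
    ultimately have zero: "x k = 0" "- x j * card (Q - S) = 0" "(\<Sum>v\<in>R - Q. max (- x v) 0) = 0"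
      using xb' Rle[OF r0R] x_k nonneg_terms(8)[of "Q - S"] max_sum_nonneg[of "\<lambda>v. - x v" "R - Q"]
        max_sum_nonneg[of "\<lambda>v. - x v" B] by linarith+
    have "Q - S = {}" using zero(2) x_j finite_Diff[OF fin_cells(2)]
      by (metis card_0_eq less_irrefl mult_eq_0_iff neg_equal_0_iff_equal of_nat_eq_0_iff)
    then have "R \<inter> Q = {}" using RS by blast
    have "x r = 0" if "r \<in> R" for r
    proof -
      have "r \<in> R - Q" using that \<open>R \<inter> Q = {}\<close> by blast
      then have "- x r \<le> 0"
        using max_sum_mem[OF finite_Diff[OF fin_cells(3)], of r Q "\<lambda>v. - x v"] zero(3) by linarith
      then show ?thesis using Rle[OF that] by linarith
    qed
    then have "(\<Sum>v\<in>R. x v) = 0" by (rule sum.neutral[rule_format])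
    then show False using sumR xh.sum_conb[OF kV] zero(1) x_i by simp
  qed
  then obtain r where r: "r \<in> R" "0 < x r" by blast
  note cr = cells(2)[OF r(1)]
  \<comment> \<open>If \<open>Sm\<close> were empty, \<open>xa\<close> would be tight, with no leak
    and \<open>x k = 0\<close>. By \<open>sum_conb\<close> at \<open>k\<close> some \<open>t\<close>
    in \<open>R\<close> would have negative \<open>x\<close>, and its edge to \<open>Pm\<close>
    would leak.\<close>
  have "Sm \<noteq> {}"
  proof
    assume "Sm = {}"
    then have xa': "x i * card (P - R) + (\<Sum>v\<in>S - P. max (x v) 0) + (\<Sum>v\<in>B. max (x v) 0)
     + xh.leak + x l * card xh.lows - x k * card xh.highs \<le> - x j"
      using xa xS by simp
    have "E p0 k" using p0' cells(1)[of p0] by (intro not_R) blast+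
    then have "- x k \<le> - x k * card xh.highs" using cells(1)[of p0] p0' by (intro xhighI[of p0]) blast+
    then have zero: "xh.leak = 0" "x k = 0"
      using xa' PR1 x_ord x_k xh.leak_nonneg nonneg_terms(2)
        max_sum_nonneg[of x B] max_sum_nonneg[of x "S - P"] by linarith+
    have "(\<Sum>v\<in>R. x v) < 0" using sumR xh.sum_conb[OF kV] zero(2) x_i by simp
    then obtain t where t: "t \<in> R" "x t < 0" by (meson not_less sum_nonneg)
    obtain p where p: "p \<in> Pm" "E p t" using no_adj[OF t(1)] by blast
    note cp = cells(1)[OF conjunct1[OF Pm[OF p(1)]]]
    have "(p, t) \<in> xh.cut"
      using cp cells(2)[OF t(1)] p(2) less_imp_le[OF t(2)] unfolding xh.mem_cut by blast
    then have "x p - x t \<le> xh.leak" by (rule xh.leak_one)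
    then show False using zero(1) cp t(2) by linarith
  qed
  then obtain s1 where s1: "s1 \<in> Sm" by blast
  \<comment> \<open>Without such a vertex \<open>zb\<close> forces \<open>r\<close> to be adjacent
    to all of \<open>Sm\<close>; these edges leak for \<open>x\<close> and break
    \<open>xa\<close>.\<close>
  have "\<exists>q\<in>Q. 0 < z q"
  proof (rule ccontr)
    assume "\<not> (\<exists>q\<in>Q. 0 < z q)"
    then have "(\<Sum>v\<in>Q. max (z v) 0) = 0" by (intro max_sum_eq_0) force
    note zb' = zb[unfolded this]
    have rs: "E r s" if s: "s \<in> Sm" for s
    proof (rule ccontr)
      assume na: "\<not> E r s"
      note cs = cells(4)[OF conjunct1[OF Sm[OF s]]]
      have "r \<noteq> s" using Sm[OF s] RS r by blast
      then have "(r, s) \<in> zcut" using na cr cs less_imp_le unfolding mem_zcut by blast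
      then have "z r - z s \<le> zleak" by (rule hubs.leak_one[OF zh])
      moreover have "\<not> E s i" using cs Sm[OF s] by (intro not_P) blast+
      then have "z i \<le> z i * card zlows" using cs by (intro zlowI[of s]) auto
      moreover have "- z l \<le> - z l * card (S - P)"
        using Sm[OF s] z_l by (intro ge_mult_card[of _ s] finite_Diff fin_cells) auto
      ultimately show False
        using zb' R_ge[OF r(1)] cs z_l nonneg_terms(6) max_sum_nonneg[of "\<lambda>v. - z v" "Q - S"]
          max_sum_nonneg[of "\<lambda>v. - z v" B] by linarith
    qed
    have "(r, s) \<in> xh.cut" if "s \<in> Sm" for s
      using cells(4)[OF conjunct1[OF Sm[OF that]]] Sm[OF that] rs[OF that] cr r(2) less_imp_le
      unfolding xh.mem_cut by blast
    then have "(\<Sum>s\<in>Sm. x r - x s) \<le> xh.leak" using fin by (intro xh.leak_down)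
    then have "card Sm * x r + (\<Sum>s\<in>Sm. - x s) \<le> xh.leak" by (simp add: sum_subtractf sum_negf)
    moreover have "x r \<le> x r * card Sm" using s1 fin r by (intro ge_mult_card) auto
    ultimately show False
      using xa xS PR1 x_ord r(2) nonneg_terms(2,3)
        max_sum_nonneg[of x B] max_sum_nonneg[of x "S - P"] by (simp add: mult.commute)
  qed
  then obtain v where v: "v \<in> Q" "0 < z v" by blast
  note cv = cells(3)[OF v(1)]
  have "v \<notin> S" using cells(4)[of v] v(2) less_asym by blast
  then have "E v l" using cv by (intro not_S) blast+
  then have al: "x l \<le> x l * card xh.lows" using cv by (intro xlowI[of v]) auto
  have "r \<notin> Q" using cells(3)[of r] r(2) less_asym by blast
  then have "\<not> E r j" using cr by (intro not_Q) blast+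
  then have de: "- z j \<le> - z j * card zhighs" using cr by (intro zhighI[of r]) auto
  \<comment> \<open>These sets split the pairs by adjacency: \<open>P0\<close> and
    \<open>Sm - S0\<close> give edges, used in \<open>xa\<close>, while \<open>Pm - P0\<close> and
    \<open>S0\<close> give non-edges, used in \<open>za\<close>.\<close>
  define S0 where "S0 = {s \<in> Sm. \<not> E r s}"
  define P0 where "P0 = {p \<in> Pm. E p v}"
  have sub: "S0 \<subseteq> Sm" "P0 \<subseteq> Pm" by (auto simp: S0_def P0_def)
  have fin0: "finite S0" "finite P0" using sub fin finite_subset by blast+
  have "(\<Sum>p\<in>P0. x p - x v) + (\<Sum>s\<in>Sm - S0. x r - x s) \<le> xh.leak"
  proof (rule xh.leak_up_down)
    fix p assume "p \<in> P0"
    then have "p \<in> Pm" "E p v" by (auto simp: P0_def)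
    then show "(p, v) \<in> xh.cut"
      using cells(1)[of p] Pm[of p] cv less_imp_le unfolding xh.mem_cut by blast
  next
    fix s assume "s \<in> Sm - S0"
    then have "s \<in> Sm" "E r s" by (auto simp: S0_def)
    then show "(r, s) \<in> xh.cut"
      using cells(4)[of s] Sm[of s] cr r(2) less_imp_le unfolding xh.mem_cut by blast
  next
    show "r \<notin> P0" using r(1) Pm sub by blast
  qed
  moreover have "(\<Sum>p\<in>P0. x p) \<le> (\<Sum>p\<in>P0. x p - x v)" using cv by (intro sum_mono) auto
  moreover have "(\<Sum>s\<in>Sm - S0. - x s) \<le> (\<Sum>s\<in>Sm - S0. x r - x s)" using r by (intro sum_mono) auto
  moreover have "x i * card P0 \<le> x l + (\<Sum>p\<in>P0. x p)"
    using Pm sub by (intro sum_P_sub) blast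
  moreover have "(\<Sum>s\<in>Sm. - x s) = (\<Sum>s\<in>Sm - S0. - x s) + (\<Sum>s\<in>S0. - x s)"
    using sub fin by (intro sum.subset_diff)
  moreover have "(\<Sum>s\<in>S0. - x s) \<le> (\<Sum>s\<in>S0. - x j)"
  proof (intro sum_mono)
    fix s assume "s \<in> S0"
    then have "s \<in> V" using sub Sm cells(4) by blast
    then show "- x s \<le> - x j" using x_ge by simp
  qed
  moreover have "(\<Sum>s\<in>S0. - x j) = - x j * card S0" by simp
  ultimately have "x i * card Pm + x i * card P0 \<le> - x j + - x j * card S0"
    using xa xS PR al nonneg_terms(3) max_sum_nonneg[of x B] max_sum_nonneg[of x "S - P"] by linarith
  also have "\<dots> \<le> x i + x i * card S0"
    using x_ord by (intro add_mono mult_right_mono) auto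
  finally have "x i * (real (card Pm) + real (card P0)) \<le> x i * (1 + real (card S0))"
    by (simp add: algebra_simps)
  then have A: "real (card Pm) + real (card P0) \<le> 1 + real (card S0)"
    using x_i by (simp only: mult_le_cancel_left_pos)
  have "(\<Sum>p\<in>Pm - P0. z v - z p) + (\<Sum>s\<in>S0. z r - z s) \<le> zleak"
  proof (rule hubs.leak_two_down[OF zh])
    fix p assume "p \<in> Pm - P0"
    then have "p \<in> Pm" "\<not> E p v" unfolding P0_def by blast+
    moreover have "v \<noteq> p" using cv Pm[OF \<open>p \<in> Pm\<close>] v by auto
    ultimately show "(v, p) \<in> zcut"
      using cells(1)[of p] Pm[of p] cv v sym less_imp_le unfolding mem_zcut by blast
  next
    fix s assume "s \<in> S0"
    then have "s \<in> Sm" "\<not> E r s" by (auto simp: S0_def)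
    moreover have "r \<noteq> s" using Sm[OF \<open>s \<in> Sm\<close>] RS r by blast
    ultimately show "(r, s) \<in> zcut"
      using cells(4)[of s] Sm[of s] cr less_imp_le unfolding mem_zcut by blast
  next
    show "v \<noteq> r" using cv r by auto
  qed
  moreover have "(\<Sum>p\<in>Pm - P0. z v - z p) = z v * card (Pm - P0) + (\<Sum>p\<in>Pm - P0. - z p)"
    by (simp add: sum_subtractf sum_negf)
  moreover have "(\<Sum>p\<in>Pm. - z p) = (\<Sum>p\<in>Pm - P0. - z p) + (\<Sum>p\<in>P0. - z p)"
    using sub fin by (intro sum.subset_diff)
  moreover have "(\<Sum>p\<in>P0. - z p) \<le> (\<Sum>p\<in>P0. - z l)"
  proof (intro sum_mono)
    fix p assume "p \<in> P0"
    then have "p \<in> V" using sub Pm cells(1) by blast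
    then show "- z p \<le> - z l" using z_ge by simp
  qed
  moreover have "(\<Sum>p\<in>P0. - z l) = - z l * card P0" by simp
  moreover have "(\<Sum>s\<in>S0. z r - z s) = z r * card S0 + (\<Sum>s\<in>S0. - z s)"
    by (simp add: sum_subtractf sum_negf)
  moreover have "(z k - z i) * card S0 \<le> z r * card S0"
    using R_ge[OF r(1)] by (intro mult_right_mono) auto
  moreover have "- z l * card S0 \<le> - z j + (\<Sum>s\<in>S0. - z s)"
    using Sm sub by (intro sum_S_sub) blast
  moreover have "z i * card S0 \<le> z i * card zlows"
  proof (intro mult_left_mono z_i of_nat_mono card_mono hubs.finite_lows[OF zh] subsetI)
    fix s assume "s \<in> S0"
    then have "s \<in> Sm" by (simp add: S0_def)
    note s = Sm[OF this] cells(4)[OF conjunct1[OF Sm[OF this]]]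
    then have "\<not> E s i" by (intro not_P) blast+
    then show "s \<in> zlows" using s less_imp_le unfolding mem_zlows by blast
  qed
  moreover have "(z k - z i) * card S0 = z k * card S0 - z i * card S0"
    by (simp add: algebra_simps)
  ultimately have B: "z k + z k * card S0 + - z l * card S0 + z v * card (Pm - P0) \<le> - z l + - z l * card P0"
    using za zP RQ de max_sum_nonneg[of z "P - R"] max_sum_nonneg[of z B] by linarith
  have "- z l * card S0 \<le> z k * card S0" using z_ord by (intro mult_right_mono) auto
  then have "- z l * (2 * real (card S0)) + z v * card (Pm - P0) \<le> - z l * card P0"
    using B z_ord by (simp add: algebra_simps)
  moreover have "0 \<le> z v * card (Pm - P0)" using v by simp
  moreover have "0 \<le> - z l * (2 * real (card S0))" using z_l by (simp add: mult_nonpos_nonneg)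
  ultimately have D: "- z l * (2 * real (card S0)) \<le> - z l * card P0"
    and C: "z v * card (Pm - P0) \<le> - z l * card P0" by linarith+
  have "0 < - z l" using z_l by simp
  from D have D: "2 * real (card S0) \<le> real (card P0)"
    by (subst (asm) mult_le_cancel_left_pos[OF \<open>0 < - z l\<close>])
  show False
  \<comment> \<open>If \<open>P0\<close> is empty, \<open>C\<close> contradicts
    \<open>z v > 0\<close>. Otherwise \<open>A\<close>, \<open>D\<close> and
    \<open>card P0 \<le> card Pm\<close> give \<open>3 * card P0 \<le> 2\<close>.\<close>
  proof (cases "card P0 = 0")
    case True
    then have "P0 = {}" using fin0 by simp
    then show False using C True v Pm1 by (simp add: mult_le_0_iff)
  next
    case False
    moreover have "card P0 \<le> card Pm" using sub fin by (intro card_mono)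
    ultimately show False using A D by linarith
  qed
qed

lemma in_B_if_singletons:
  assumes "P = {r}" "Q = {q}" "R = {r}" "S = {q}" "w \<in> V" "w \<notin> {i, j, k, l, r, q}"
  shows "w \<in> B"
proof -
  have "w \<notin> P" unfolding assms(1) using assms(6) by blast
  moreover have "w \<notin> Q" unfolding assms(2) using assms(6) by blast
  moreover have "w \<notin> R" unfolding assms(3) using assms(6) by blast
  moreover have "w \<notin> S" unfolding assms(4) using assms(6) by blast
  ultimately show ?thesis using assms(5,6) by blast
qed

text \<open>
  With \<open>0 \<le> z\<close> on \<open>P\<close>, the inequality \<open>za\<close> is tight, which determines \<open>z\<close> on all cells and makes the
  vertex \<open>r\<close> of \<open>R - Q\<close> adjacent to every vertex with \<open>z \<le> 0\<close>; then \<open>xa\<close> is almost tight as well.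
\<close>

lemma impossible: False
proof -
  have zP: "(\<Sum>v\<in>P. max (- z v) 0) = 0"
    using z_P_nonneg by (intro max_sum_eq_0) simp
  note za' = za[unfolded zP]
  have PS: "P \<inter> S = {}" using z_P_nonneg cells(4) not_less by blast
  have SP: "S - P = S" using PS by blast
  obtain r where r: "r \<in> R" "r \<notin> Q" using R_not_subset_Q by blast
  note cr = cells(2)[OF r(1)]
  have RQ: "z k \<le> z k * card (R - Q)"
    using r z_k by (intro ge_mult_card[of _ r] finite_Diff fin_cells) auto
  have "\<not> E r j" using cr r(2) by (intro not_Q) blast+
  then have de: "- z j \<le> - z j * card zhighs" using cr by (intro zhighI[of r]) auto
  obtain s0 where s0: "s0 \<in> S" using S_ne by blast
  have "\<not> E s0 i" using cells(4)[OF s0] PS s0 by (intro not_P) blast+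
  then have ga: "z i \<le> z i * card zlows" using cells(4)[OF s0] by (intro zlowI[of s0]) auto
  \<comment> \<open>The terms \<open>RQ\<close>, \<open>de\<close> and \<open>ga\<close> already
    bring the left side of \<open>za'\<close> up to \<open>z k\<close>, while the right side is at
    most \<open>z k\<close>; so every other term is zero.\<close>
  have zero: "z k = - z l" "z k * card (R - Q) = z k" "z i = 0" "z j = 0" "zleak = 0"
      "(\<Sum>v\<in>P - R. max (z v) 0) = 0" "(\<Sum>v\<in>B. max (z v) 0) = 0"
    using za' RQ de ga z_ord z_i z_j hubs.leak_nonneg[OF zh]
      max_sum_nonneg[of z "P - R"] max_sum_nonneg[of z B] by linarith+
  have "card (R - Q) \<le> 1" using zero(2) z_k by simp
  then have "\<forall>v\<in>R - Q. \<forall>w\<in>R - Q. v = w"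
    by (subst (asm) One_nat_def, subst (asm) card_le_Suc0_iff_eq) (rule finite_Diff, rule fin_cells(3))
  then have RQr: "R - Q = {r}" using r by blast
  have zS: "z s = z l" if "s \<in> S" for s
    using S_le[OF that] z_ge[of s] cells(4)[OF that] zero(4) by simp
  have zPR: "z p \<le> 0" if "p \<in> P - R" for p
    using max_sum_mem[OF finite_Diff[OF fin_cells(1)] that, of z] zero(6) by linarith
  have zB: "z b \<le> 0" if "b \<in> B" for b
    using max_sum_mem[OF fin_cells(5) that, of z] zero(7) by linarith
  have rw: "E r w" if w: "w \<in> V" "w \<noteq> i" "w \<noteq> j" "z w \<le> 0" for w
  proof (rule ccontr)
    assume "\<not> E r w"
    moreover have "r \<noteq> w" using w cr by auto
    ultimately have "(r, w) \<in> zcut" using w cr unfolding mem_zcut by blast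
    then have "z r - z w \<le> zleak" by (rule hubs.leak_one[OF zh])
    then show False using zero(5) w cr by linarith
  qed
  have "(\<Sum>w\<in>nb i. z w) = z l + (\<Sum>w\<in>P. z w)"
    using il lV by (intro sum.remove) auto
  then have "0 < (\<Sum>w\<in>P. z w)" using sum_z_nb[OF iV] zero(3) z_l by simp
  then obtain p0 where "p0 \<in> P" "0 < z p0" by (meson not_less sum_nonpos)
  then have "p0 \<in> R" using zPR[of p0] by (meson DiffI not_less)
  then have "p0 \<in> R - Q" using PQ \<open>p0 \<in> P\<close> by blast
  then have rP: "r \<in> P" using \<open>p0 \<in> P\<close> unfolding RQr by blast
  have xr: "0 < x r" "x i - x l \<le> x r" using cells(1)[OF rP] P_ge[OF rP] by blast+
  have "(\<Sum>w\<in>nb j. z w) = z k + (\<Sum>w\<in>Q. z w)"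
    using kj sym kV by (intro sum.remove) auto
  then have zQ: "(\<Sum>w\<in>Q. z w) = - z k" using sum_z_nb[OF jV] zero(4) by simp
  then have "(\<Sum>w\<in>Q. z w) < 0" using z_k by simp
  then obtain q where q: "q \<in> Q" "z q < 0" by (meson not_less sum_nonneg)
  \<comment> \<open>By \<open>rw\<close>, \<open>r\<close> is adjacent to all of \<open>T\<close>,
    so every pair \<open>(r, w)\<close> leaks for \<open>x\<close>. Since \<open>T\<close> contains
    \<open>Sm\<close>, this leak absorbs the negative part of \<open>x\<close> on \<open>S\<close>
    in \<open>xa\<close>, which gives \<open>base\<close>.\<close>
  define T where "T = {w \<in> V - {i, j, k, l}. z w \<le> 0 \<and> x w \<le> 0}"
  have finT: "finite T" using finV by (simp add: T_def)
  have memT: "w \<in> T \<longleftrightarrow> w \<in> V \<and> w \<noteq> i \<and> w \<noteq> j \<and> w \<noteq> k \<and> w \<noteq> l \<and> z w \<le> 0 \<and> x w \<le> 0" for w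
    unfolding T_def by blast
  have "(r, w) \<in> xh.cut" if "w \<in> T" for w
    using that rw[of w] cr xr unfolding memT xh.mem_cut by blast
  then have "(\<Sum>w\<in>T. x r - x w) \<le> xh.leak" using finT by (intro xh.leak_down)
  then have leak: "x r * card T + (\<Sum>w\<in>T. - x w) \<le> xh.leak"
    by (simp add: sum_subtractf sum_negf mult.commute)
  define Sm where "Sm = {s \<in> S. x s < 0}"
  have xS: "(\<Sum>v\<in>S. max (- x v) 0) = (\<Sum>s\<in>Sm. - x s)"
    unfolding Sm_def by (subst max_sum_filter[OF fin_cells(4)]) (simp only: neg_0_less_iff_less)
  have SmT: "Sm \<subseteq> T"
    using cells(4) less_imp_le unfolding Sm_def memT subset_iff by blast
  have split: "(\<Sum>w\<in>T. - x w) = (\<Sum>w\<in>T - Sm. - x w) + (\<Sum>w\<in>Sm. - x w)"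
    using SmT finT by (intro sum.subset_diff)
  have rest: "0 \<le> (\<Sum>w\<in>T - Sm. - x w)" by (intro sum_nonneg) (simp add: memT)
  have qT: "q \<in> T" using q cells(3)[OF q(1)] less_imp_le unfolding memT by blast
  have T1: "x r \<le> x r * card T" using finT qT xr by (intro ge_mult_card) auto
  have base: "x i * card (P - R) + (\<Sum>v\<in>S. max (x v) 0) + (\<Sum>v\<in>B. max (x v) 0)
     + x r * card T + (\<Sum>w\<in>T - Sm. - x w) + x l * card xh.lows - x k * card xh.highs \<le> - x j"
    using xa[unfolded SP xS] leak split by linarith
  \<comment> \<open>A vertex of \<open>Q\<close> outside \<open>S\<close> would add
    \<open>- x w > 0\<close> and, as a member of \<open>lows\<close>, also \<open>x l\<close> to the
    left side of \<open>base\<close>, which already contains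
    \<open>x r \<ge> x i - x l\<close>.\<close>
  have QS: "w \<in> S" if w: "w \<in> Q" "z w \<le> 0" for w
  proof (rule ccontr)
    assume "w \<notin> S"
    note cw = cells(3)[OF w(1)]
    have wT: "w \<in> T" using w cw less_imp_le unfolding memT by blast
    have "w \<notin> Sm" using \<open>w \<notin> S\<close> unfolding Sm_def by blast
    then have "- x w \<le> (\<Sum>w\<in>T - Sm. - x w)"
      using wT finT by (intro member_le_sum) (auto simp: memT)
    moreover have "E w l" using cw \<open>w \<notin> S\<close> by (intro not_S) blast+
    then have "x l \<le> x l * card xh.lows" using cw by (intro xlowI[of w]) auto
    ultimately show False
      using base T1 xr x_ord cw nonneg_terms(3) nonneg_terms(7)[of "P - R"] max_sum_nonneg[of x B] max_sum_nonneg[of x S]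
      by linarith
  qed
  have qS: "q \<in> S" using QS[OF q(1)] q(2) by simp
  have zq: "z q = - z k" using zS[OF qS] zero(1) by simp
  show False
  \<comment> \<open>A member of \<open>lows\<close> makes \<open>base\<close> tight and collapses
    the graph to six vertices. If there is none, only \<open>B\<close> can be large, and the
    equations at \<open>r\<close> and \<open>l\<close> decide.\<close>
  proof (cases "xh.lows = {}")
    case False
    then obtain w where w: "w \<in> xh.lows" by blast
    then have "x l \<le> x l * card xh.lows"
      using w by (intro xlowI[of w]) (simp_all add: xh.mem_lows)
    then have tight: "x i * card (P - R) = 0" "(\<Sum>v\<in>S. max (x v) 0) = 0" "(\<Sum>v\<in>B. max (x v) 0) = 0"
      "x r * card T = x r"
      using base T1 xr x_ord rest nonneg_terms(3) nonneg_terms(7)[of "P - R"] max_sum_nonneg[of x B] max_sum_nonneg[of x S]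
      by linarith+
    have "card (P - R) = 0" using tight(1) x_i by simp
    then have "P - R = {}" by (subst (asm) card_0_eq[OF finite_Diff[OF fin_cells(1)]])
    then have P: "P = {r}" using RQr PQ rP by blast
    have "card T = 1" using tight(4) xr by simp
    then have T: "T = {q}" using qT by (auto simp: card_1_singleton_iff)
    have "s \<in> T" if "s \<in> S" for s
    proof -
      have "x s \<le> 0" using max_sum_mem[OF fin_cells(4) that, of x] tight(2) by linarith
      then show ?thesis using cells(4)[OF that] less_imp_le unfolding memT by blast
    qed
    then have S: "S = {q}" using qS unfolding T by blast
    have "b \<in> T" if "b \<in> B" for b
    proof -
      have "x b \<le> 0" using max_sum_mem[OF fin_cells(5) that, of x] tight(3) by linarith
      then show ?thesis using cells(5)[OF that] zB[OF that] unfolding memT by blast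
    qed
    moreover have "q \<notin> B" using q(1) by blast
    ultimately have B: "B = {}" unfolding T by blast
    have "(\<Sum>w\<in>Q. z w) = z q + (\<Sum>w\<in>Q - {q}. z w)" using q by (intro sum.remove fin_cells)
    then have "(\<Sum>w\<in>Q - {q}. z w) = 0" using zQ zq by simp
    moreover have "0 < z w" if "w \<in> Q - {q}" for w
      using QS[of w] that unfolding S by (meson DiffD1 DiffD2 not_less)
    ultimately have "Q - {q} = {}"
      using sum_pos[OF finite_Diff[OF fin_cells(2)], of "{q}" z] by (metis less_irrefl)
    then have Q: "Q = {q}" using q by blast
    have "R \<inter> Q = {}" using RS qS unfolding Q by blast
    then have R: "R = {r}" using RQr by blast
    have "V \<subseteq> {i, j, k, l, r, q}"
      using in_B_if_singletons[OF P Q R S] unfolding B by blast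
    then have "card V \<le> card {i, j, k, l, r, q}" by (intro card_mono) auto
    also have "\<dots> \<le> 6" by (simp add: card_insert_if)
    finally show False using card_V by simp
  next
    case True
    have low: "0 < x w" if "w \<in> V" "w \<noteq> k" "w \<noteq> l" "E w l" for w
    proof (rule ccontr)
      assume "\<not> 0 < x w"
      then have "w \<in> xh.lows" using that by (simp add: xh.mem_lows)
      then show False using True by simp
    qed
    have QsubS: "w \<in> S" if w: "w \<in> Q" for w
    proof (rule ccontr)
      assume "w \<notin> S"
      note cw = cells(3)[OF w]
      have "E w l" using cw \<open>w \<notin> S\<close> by (intro not_S) blast+
      then show False using low[of w] cw by auto
    qed
    then have "R \<inter> Q = {}" using RS by blast
    then have R: "R = {r}" using RQr by blast
    have "(\<Sum>w\<in>Q. z w) = (\<Sum>w\<in>Q. - z k)"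
    proof (intro sum.cong refl)
      fix w assume "w \<in> Q"
      then show "z w = - z k" using zS[OF QsubS] zero(1) by simp
    qed
    also have "\<dots> = - z k * card Q" by simp
    finally have "- z k * card Q = - z k * 1" using zQ by linarith
    then have "card Q = 1" using z_k by simp
    then obtain q' where q': "Q = {q'}" by (rule card_1_singletonE)
    have "q = q'" using q(1) unfolding q' by (rule singletonD)
    then have Q: "Q = {q}" using q' by (simp only:)
    have "(\<Sum>v\<in>Q. max (z v) 0) = 0" unfolding Q using q by simp
    then have "- z l * card S \<le> z k"
      using zb[unfolded SP] nonneg_terms(4,5,6) max_sum_nonneg[of "\<lambda>v. - z v" "Q - S"]
        max_sum_nonneg[of "\<lambda>v. - z v" B] by linarith
    then have "z k * card S \<le> z k" by (simp only: zero(1))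
    then have "card S \<le> 1" using z_k by simp
    then have "\<forall>v\<in>S. \<forall>w\<in>S. v = w"
      by (subst (asm) One_nat_def, subst (asm) card_le_Suc0_iff_eq) (rule fin_cells(4))
    then have S: "S = {q}" using qS by blast
    have xi: "x i * card (P - R) + (\<Sum>v\<in>B. max (x v) 0) + x r - x k * card xh.highs \<le> - x j"
      using base T1 rest nonneg_terms(2) max_sum_nonneg[of x S] by linarith
    have "P - R = {}"
    proof (rule ccontr)
      assume "P - R \<noteq> {}"
      then obtain p where "p \<in> P - R" by blast
      then have "x i \<le> x i * card (P - R)"
        using x_i by (intro ge_mult_card[of _ p] finite_Diff fin_cells) auto
      then show False using xi xr x_ord nonneg_terms(3) max_sum_nonneg[of x B] by linarith
    qed
    then have P: "P = {r}" using rP unfolding R by blast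
    have al: "x l = x i - x r" using sum_P unfolding P by simp
    note cover = in_B_if_singletons[OF P Q R S]
    have "V \<subseteq> {i, j, k, l, r, q} \<union> B" using cover by blast
    then have "card V \<le> card ({i, j, k, l, r, q} \<union> B)" by (intro card_mono) (auto simp: finV)
    also have "\<dots> \<le> card {i, j, k, l, r, q} + card B" by (rule card_Un_le)
    also have "card {i, j, k, l, r, q} \<le> 6" by (simp add: card_insert_if)
    finally have B2: "2 \<le> card B" using card_V by simp
    have kj_ne: "k \<noteq> j" using kj irr by auto
    \<comment> \<open>By \<open>rw\<close> the vertex \<open>r\<close> misses only \<open>k\<close>
      and \<open>j\<close>, so it has \<open>card V - 3 \<ge> 5\<close> neighbours. Then
      \<open>sum_conb\<close> at \<open>r\<close> makes \<open>x r\<close> small, as stated in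
      \<open>five\<close>.\<close>
    have conb_r: "conb r = {k, j}"
    proof
      show "conb r \<subseteq> {k, j}"
      proof
        fix w assume w: "w \<in> conb r"
        then have w': "w \<in> V" "w \<noteq> r" "\<not> E r w" by auto
        have "w \<noteq> i" "w \<noteq> l" using w' cr cells(1)[OF rP] sym by blast+
        show "w \<in> {k, j}"
        proof (rule ccontr)
          assume "w \<notin> {k, j}"
          then have "w \<in> B \<or> w = q"
            using cover[of w] w' \<open>w \<noteq> i\<close> \<open>w \<noteq> l\<close> by blast
          then have "z w \<le> 0" using zB q by auto
          then show False using rw[of w] w' \<open>w \<noteq> i\<close> \<open>w \<notin> {k, j}\<close> by blast
        qed
      qed
      show "{k, j} \<subseteq> conb r" using cr \<open>\<not> E r j\<close> kV jV by auto
    qed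
    have "card (conb r) = 2" unfolding conb_r using kj_ne by simp
    then have "card (nb r) + 3 = card V" using card_conb[of r] cr by simp
    then have nbr: "5 \<le> real (card (nb r))" using card_V by simp
    have "(\<Sum>w\<in>conb r. x w) = x k + x j" unfolding conb_r using kj_ne by simp
    then have "card (nb r) * x r = - x k - x j" using xh.sum_conb[of r] cr by simp
    moreover have "5 * x r \<le> card (nb r) * x r" using nbr xr by (intro mult_right_mono) auto
    ultimately have five: "5 * x r \<le> - x k - x j" by linarith
    have xB: "0 < x b" if "b \<in> B" for b using low[of b] cells(5)[OF that] by blast
    have "(\<Sum>v\<in>B. max (x v) 0) = (\<Sum>v\<in>B. x v)"
      by (intro sum.cong refl max_absorb1 less_imp_le xB)
    note xi = xi[unfolded this]
    have "B \<subseteq> xh.highs"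
      using xB cells(5) unfolding subset_iff xh.mem_highs by blast
    then have "card B \<le> card xh.highs" by (rule card_mono[OF xh.finite_highs])
    then have np: "- x k * card B \<le> - x k * card xh.highs" using x_k by (intro mult_left_mono) auto
    have nbl: "nb l = insert i (insert k (insert r B))"
    proof
      show "nb l \<subseteq> insert i (insert k (insert r B))"
      proof
        fix w assume w: "w \<in> nb l"
        then have w': "w \<in> V" "E l w" by auto
        then have "w \<noteq> l" "w \<noteq> j" "w \<noteq> q" using jl sym irr cells(4)[OF qS] by blast+
        then show "w \<in> insert i (insert k (insert r B))"
          using cover[of w] w' by blast
      qed
      show "insert i (insert k (insert r B)) \<subseteq> nb l"
        using iV kV il kl sym cr cells(5) unfolding subset_iff insert_iff mem_nb by blast
    qed
    have "(\<Sum>w\<in>nb l. x l - x w) = (x l - x i) + (x l - x k) + (x l - x r) + (\<Sum>w\<in>B. x l - x w)"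
    proof -
      have "i \<notin> insert k (insert r B)" "k \<notin> insert r B" "r \<notin> B"
        using neq cr rP by blast+
      then show ?thesis unfolding nbl using fin_cells(5) by simp
    qed
    moreover have "(\<Sum>w\<in>B. x l - x w) = x l * card B - (\<Sum>w\<in>B. x w)"
      by (simp add: sum_subtractf)
    \<comment> \<open>The equation at \<open>l\<close> determines the sum of \<open>x\<close> over
      \<open>B\<close>. Inserted into \<open>xi\<close> with \<open>2 \<le> card B\<close>, it
      forces \<open>x r\<close> to be large, against \<open>five\<close>.\<close>
    ultimately have SB: "(\<Sum>w\<in>B. x w) = 2 * x l - x i - x k - x r + x l * card B"
      using eigx[OF lV] by (simp add: lapl_def)
    have "(x l - x k) * 2 \<le> (x l - x k) * card B"
      using B2 xh.x_l x_k by (intro mult_left_mono) auto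
    moreover have "(x l - x k) * 2 = 2 * x l - 2 * x k" by simp
    moreover have "(x l - x k) * card B = x l * card B - x k * card B" by (simp add: algebra_simps)
    ultimately have "4 * x l - x i - 3 * x k \<le> - x j"
      using xi np SB nonneg_terms(7)[of "P - R"] by linarith
    then show False using al five x_ord x_k x_i by linarith
  qed
qed

end

text \<open>One of the four rotations satisfies both order assumptions.\<close>

lemma (in extremal_config) card_less: "card V < 8"
proof (rule ccontr)
  assume "\<not> card V < 8"
  then have n: "8 \<le> card V" by simp
  have imp: False if "extremal_config V' E' x' z' i' j' k' l'" "- x' j' \<le> x' i'" "- z' l' \<le> z' k'" "8 \<le> card V'"
    for V' :: "'a set" and E' x' z' i' j' k' l'
    using ordered_config.impossible[OF ordered_config.intro[OF that(1)], unfolded ordered_config_axioms_def] that(2-4)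
    by blast
  consider "- x j \<le> x i" "- z l \<le> z k" | "- z l \<le> z k" "x i \<le> - x j"
    | "x i \<le> - x j" "z k \<le> - z l" | "z k \<le> - z l" "- x j \<le> x i" by linarith
  then show False
  proof cases
    case 1 then show False by (intro imp[OF extremal_config_axioms _ _ n])
  next
    case 2 then show False by (intro imp[OF rot _ _ n]) simp_all
  next
    case 3 then show False by (intro imp[OF rot2 _ _ n]) simp_all
  next
    case 4 then show False by (intro imp[OF rot3 _ _ n]) simp_all
  qed
qed

section \<open>Extremal configurations from eigenvectors\<close>

context fin_graph
begin

text \<open>The handshake lemma: an injection into the naturals orients each edge, which splits the
  ordered adjacent pairs into \<open>U\<close> and its equally large mirror image.\<close>

lemma even_sum_degree: "even (\<Sum>v\<in>V. card (nb v))"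
proof -
  obtain f :: "'a \<Rightarrow> nat" where f: "inj_on f V"
    using finite_imp_inj_to_nat_seg[OF finV] by blast
  define U where "U = {(u, v). u \<in> V \<and> v \<in> V \<and> E u v \<and> f u < f v}"
  have finU: "finite U" by (rule finite_subset[of _ "V \<times> V"]) (use finV in \<open>auto simp: U_def\<close>)
  have "Sigma V nb = U \<union> prod.swap ` U"
  proof
    show "Sigma V nb \<subseteq> U \<union> prod.swap ` U"
    proof
      fix p assume "p \<in> Sigma V nb"
      then obtain u v where p: "p = (u, v)" "u \<in> V" "v \<in> V" "E u v" by auto
      then have "f u \<noteq> f v" using f irr inj_onD[of f V u v] by auto
      then have "(u, v) \<in> U \<or> (v, u) \<in> U" using p sym by (auto simp: U_def)
      then show "p \<in> U \<union> prod.swap ` U" unfolding p by force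
    qed
  qed (use sym in \<open>auto simp: U_def\<close>)
  then have "card (Sigma V nb) = card U + card (prod.swap ` U)"
    using finU by (simp only:) (intro card_Un_disjoint; force simp: U_def)
  also have "card (prod.swap ` U) = card U" by (intro card_image) simp
  finally show ?thesis using finV by simp
qed

text \<open>
  Since \<open>L * L' = n * L - L\<^sup>2\<close> for the Laplacian \<open>L'\<close> of the complement, this says that
  \<open>(L - 1) * (n - 1 - L)\<close> is positive semidefinite on the orthogonal complement of the constants.
\<close>

definition spectral_bound :: bool where
  "spectral_bound \<longleftrightarrow> (\<forall>y :: 'a \<Rightarrow> real. (real (card V) - 1) * ((\<Sum>v\<in>V. (y v)\<^sup>2) - (\<Sum>v\<in>V. y v)\<^sup>2 / card V)
     \<le> (\<Sum>v\<in>V. lap y v * colap y v))"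

lemma spectral_bound_compl: "spectral_bound \<Longrightarrow> fin_graph.spectral_bound V (compl_rel E)"
  by (simp add: spectral_bound_def fin_graph.spectral_bound_def[OF compl_graph] compl_compl mult.commute)

lemma lap_ind:
  "lap (\<lambda>w. of_bool (w \<in> H)) v = (if v \<in> H then card (nb v - H) else - real (card (nb v \<inter> H)))"
proof (cases "v \<in> H")
  case True
  then have "lap (\<lambda>w. of_bool (w \<in> H)) v = (\<Sum>w\<in>nb v. of_bool (w \<notin> H))"
    unfolding lapl_def by (intro sum.cong refl) simp
  then show ?thesis using True by (simp add: sum_of_bool_eq Diff_eq Compl_eq)
next
  case False
  then have "lap (\<lambda>w. of_bool (w \<in> H)) v = - (\<Sum>w\<in>nb v. of_bool (w \<in> H))"
    unfolding lapl_def sum_negf[symmetric] by (intro sum.cong refl) simp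
  then show ?thesis using False by (simp add: sum_of_bool_eq)
qed

text \<open>The bound fails for the indicator of \<open>H\<close>: its Laplacian is 1 on
  \<open>H\<close>, \<open>- h\<close> at \<open>u\<close> and 0 elsewhere, and that of the
  complement vanishes at \<open>u\<close>. After multiplication by \<open>n\<close> the two sides
  differ by \<open>h * h\<close> in the wrong direction.\<close>

lemma spectral_bound_no_cut:
  assumes spectral_bound and H: "H \<subseteq> V" "H \<noteq> {}" and u: "u \<in> V" "u \<notin> H"
    and adj: "\<And>h. h \<in> H \<Longrightarrow> E h u" and only: "\<And>h w. h \<in> H \<Longrightarrow> w \<in> V \<Longrightarrow> E h w \<Longrightarrow> w = u \<or> w \<in> H"
  shows False
proof -
  define y :: "'a \<Rightarrow> real" where "y = (\<lambda>w. of_bool (w \<in> H))"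
  define n h where "n = real (card V)" and "h = real (card H)"
  have finH: "finite H" using H finV finite_subset by blast
  have h: "0 < h" using H finH by (simp add: h_def card_gt_0_iff)
  have n: "0 < n" using u finV by (auto simp: n_def card_gt_0_iff)
  have VH: "V \<inter> H = H" using H by blast
  have sums: "(\<Sum>v\<in>V. y v) = h" "(\<Sum>v\<in>V. (y v)\<^sup>2) = h"
    using finV VH by (simp_all add: y_def h_def sum_of_bool_eq power2_eq_square flip: of_bool_conj)
  have co: "colap y v = n * y v - h - lap y v" if "v \<in> V" for v
    using lap_co[OF that, of y] sums by (simp add: n_def)
  have lapH: "lap y v = 1" if "v \<in> H" for v
  proof -
    have "nb v - H = {u}"
    proof
      show "nb v - H \<subseteq> {u}" using only[OF that] unfolding subset_iff Diff_iff mem_nb by blast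
      show "{u} \<subseteq> nb v - H" using u adj[OF that] by auto
    qed
    then show ?thesis using that H lap_ind[of H v] by (auto simp: y_def)
  qed
  have lapu: "lap y u = - h"
  proof -
    have "nb u \<inter> H = H" using adj sym H by auto
    then show ?thesis using u lap_ind[of H u] by (simp add: y_def h_def)
  qed
  have lap0: "lap y v = 0" if "v \<in> V - H" "v \<noteq> u" for v
  proof -
    have "\<not> E v w" if "w \<in> H" for w using only[OF that, of v] sym[of v w] \<open>v \<in> V - H\<close> \<open>v \<noteq> u\<close> by blast
    then have "nb v \<inter> H = {}" by auto
    then show ?thesis using that lap_ind[of H v] by (simp add: y_def)
  qed
  have "(\<Sum>v\<in>V. lap y v * colap y v) = (\<Sum>v\<in>H. n - h - 1)"
  proof (rule sum.mono_neutral_cong_right)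
    show "\<forall>v\<in>V - H. lap y v * colap y v = 0"
    proof
      fix v assume v: "v \<in> V - H"
      then have "y v = 0" by (simp add: y_def)
      then show "lap y v * colap y v = 0"
        using lap0[OF v] lapu co[OF u(1)] by (cases "v = u") auto
    qed
    fix v assume v: "v \<in> H"
    then have "v \<in> V" using H by blast
    then show "lap y v * colap y v = n - h - 1" using co[of v] lapH[OF v] v by (simp add: y_def)
  qed (use finV H in auto)
  also have "\<dots> = h * (n - h - 1)" by (simp add: h_def)
  finally have "(n - 1) * (h - h\<^sup>2 / n) \<le> h * (n - h - 1)"
    using \<open>spectral_bound\<close> sums unfolding spectral_bound_def by (metis n_def)
  then have "n * ((n - 1) * (h - h\<^sup>2 / n)) \<le> n * (h * (n - h - 1))"
    using n by (intro mult_left_mono) auto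
  moreover have "n * ((n - 1) * (h - h\<^sup>2 / n)) = n * (h * (n - h - 1)) + h * h"
    using n by (simp add: field_simps power2_eq_square)
  ultimately show False using mult_pos_pos[OF h h] by linarith
qed

text \<open>The indicator of an isolated vertex violates the bound directly; the neighbour of a
  vertex of degree 1 is its only exit, as excluded by \<open>spectral_bound_no_cut\<close>.\<close>

lemma spectral_bound_degree:
  assumes spectral_bound "2 \<le> card V" "v \<in> V"
  shows "2 \<le> card (nb v)"
proof (rule ccontr)
  assume "\<not> 2 \<le> card (nb v)"
  then consider "card (nb v) = 0" | "card (nb v) = 1" by linarith
  then show False
  proof cases
    case 1
    then have nb: "nb v = {}" by simp
    define y :: "'a \<Rightarrow> real" where "y = (\<lambda>w. of_bool (w \<in> {v}))"
    have lap0: "lap y w = 0" if "w \<in> V" for w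
    proof -
      have "w \<notin> nb v" using nb by blast
      then have "v \<notin> nb w" using sym that unfolding mem_nb by blast
      then show ?thesis using lap_ind[of "{v}" w] nb by (auto simp: y_def)
    qed
    have y1: "(\<Sum>w\<in>V. y w) = 1"
      using finV assms(3) by (simp add: y_def of_bool_def)
    have "(y w)\<^sup>2 = y w" for w by (simp add: y_def)
    then have "(\<Sum>w\<in>V. (y w)\<^sup>2) = 1" using y1 by simp
    moreover note y1
    moreover have "(\<Sum>w\<in>V. lap y w * colap y w) = 0" using lap0 by simp
    ultimately have "(real (card V) - 1) * (1 - 1 / card V) \<le> 0"
      using \<open>spectral_bound\<close>[unfolded spectral_bound_def, rule_format, of y] by simp
    moreover have "0 < (real (card V) - 1) * (1 - 1 / card V)"
      using assms(2) by (intro mult_pos_pos) (simp_all add: field_simps)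
    ultimately show False by linarith
  next
    case 2
    then obtain u where nb: "nb v = {u}" by (rule card_1_singletonE)
    then have "u \<in> nb v" by simp
    then have u: "u \<in> V" "E v u" "u \<noteq> v" using irr by auto
    have only: "w = u" if "w \<in> V" "E v w" for w
    proof -
      have "w \<in> nb v" using that by simp
      then show ?thesis unfolding nb by simp
    qed
    show False
      by (rule spectral_bound_no_cut[OF \<open>spectral_bound\<close>, of "{v}" u]) (use u only assms(3) in blast)+
  qed
qed

end

context eigen_graph
begin

text \<open>
  A common neighbour \<open>u\<close> of a maximum \<open>i\<close> and a minimum \<open>j\<close> has \<open>x u = 0\<close> and is the only neighbour of \<open>j\<close>
  at which \<open>x\<close> is not minimal. If all extremal pairs had one, the same \<open>u\<close> would separate all maxima
  from the rest, against \<open>spectral_bound_no_cut\<close>.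
\<close>

lemma far_pair:
  assumes spectral_bound and nz: "\<exists>v\<in>V. x v \<noteq> 0"
  obtains i j where "i \<in> V" "j \<in> V" "\<And>v. v \<in> V \<Longrightarrow> x v \<le> x i" "\<And>v. v \<in> V \<Longrightarrow> x j \<le> x v"
    "0 < x i" "x j < 0" "\<not> E i j" "\<And>v. v \<in> V \<Longrightarrow> \<not> (E i v \<and> E j v)"
proof -
  have ne: "V \<noteq> {}" using nz by blast
  define a b where "a = Max (x ` V)" and "b = Min (x ` V)"
  have a: "x v \<le> a" and b: "b \<le> x v" if "v \<in> V" for v
    using that finV by (auto simp: a_def b_def)
  have "a \<in> x ` V" "b \<in> x ` V" using ne finV by (auto simp: a_def b_def)
  then obtain i0 j0 where i0: "i0 \<in> V" "x i0 = a" and j0: "j0 \<in> V" "x j0 = b" by auto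
  have "0 < a"
  proof (rule ccontr)
    assume "\<not> 0 < a"
    then have "\<And>v. v \<in> V \<Longrightarrow> 0 \<le> - x v" using a by force
    then have "\<forall>v\<in>V. - x v = 0"
      using sum_nonneg_eq_0_iff[OF finV, of "\<lambda>v. - x v"] sum_x by (simp add: sum_negf)
    then show False using nz by auto
  qed
  have "b < 0"
  proof (rule ccontr)
    assume "\<not> b < 0"
    then have "\<And>v. v \<in> V \<Longrightarrow> 0 \<le> x v" using b by force
    then have "\<forall>v\<in>V. x v = 0"
      using sum_nonneg_eq_0_iff[OF finV, of x] sum_x by simp
    then show False using nz by auto
  qed
  \<comment> \<open>The maximum principle: the deficits at the neighbours of a maximum
    \<open>i\<close> sum to \<open>a\<close>, so those at the neighbours other than \<open>u\<close>
    sum to \<open>x u\<close>.\<close>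
  have up: "0 \<le> x u \<and> (x u = 0 \<longrightarrow> (\<forall>w\<in>nb i. w = u \<or> x w = a))" if "i \<in> V" "x i = a" "u \<in> nb i" for i u
  proof -
    have "a = (a - x u) + (\<Sum>w\<in>nb i - {u}. a - x w)"
      using eig[of i] that sum.remove[of "nb i" u "\<lambda>w. a - x w"] by (simp add: lapl_def)
    then have eq: "(\<Sum>w\<in>nb i - {u}. a - x w) = x u" by linarith
    have nn: "0 \<le> a - x w" if "w \<in> nb i - {u}" for w using a[of w] that by simp
    have "0 \<le> (\<Sum>w\<in>nb i - {u}. a - x w)" by (rule sum_nonneg) (rule nn)
    then have "0 \<le> x u" using eq by simp
    moreover have "\<forall>w\<in>nb i - {u}. a - x w = 0" if "x u = 0"
      using sum_nonneg_eq_0_iff[of "nb i - {u}" "\<lambda>w. a - x w", OF _ nn] eq that by simp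
    then have "\<forall>w\<in>nb i. w = u \<or> x w = a" if "x u = 0" using that by (metis Diff_iff singletonD eq_iff_diff_eq_0)
    ultimately show ?thesis by blast
  qed
  have down: "x u \<le> 0 \<and> (x u = 0 \<longrightarrow> (\<forall>w\<in>nb j. w = u \<or> x w = b))" if "j \<in> V" "x j = b" "u \<in> nb j" for j u
  proof -
    have "b = (b - x u) + (\<Sum>w\<in>nb j - {u}. b - x w)"
      using eig[of j] that sum.remove[of "nb j" u "\<lambda>w. b - x w"] by (simp add: lapl_def)
    then have eq: "(\<Sum>w\<in>nb j - {u}. x w - b) = - x u" by (simp add: sum_subtractf)
    have nn: "0 \<le> x w - b" if "w \<in> nb j - {u}" for w using b[of w] that by simp
    have "0 \<le> (\<Sum>w\<in>nb j - {u}. x w - b)" by (rule sum_nonneg) (rule nn)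
    then have "0 \<le> - x u" using eq by simp
    moreover have "\<forall>w\<in>nb j - {u}. x w - b = 0" if "x u = 0"
      using sum_nonneg_eq_0_iff[of "nb j - {u}" "\<lambda>w. x w - b", OF _ nn] eq that by simp
    then have "\<forall>w\<in>nb j. w = u \<or> x w = b" if "x u = 0" using that by (metis Diff_iff singletonD eq_iff_diff_eq_0)
    ultimately show ?thesis by (simp only: neg_0_le_iff_le) blast
  qed
  have "\<exists>i\<in>V. \<exists>j\<in>V. x i = a \<and> x j = b \<and> (\<forall>v\<in>V. \<not> (E i v \<and> E j v))"
  proof (rule ccontr)
    assume none: "\<not> ?thesis"
    define H where "H = {v \<in> V. x v = a}"
    have common: "\<exists>u\<in>V. E h u \<and> E j0 u \<and> x u = 0" if "h \<in> H" for h
    proof -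
      have h: "h \<in> V" "x h = a" using that by (auto simp: H_def)
      then obtain u where u: "u \<in> V" "E h u" "E j0 u" using none j0 by blast
      then show ?thesis using up[OF h, of u] down[OF j0, of u] by force
    qed
    have "i0 \<in> H" using i0 by (simp add: H_def)
    then obtain u where u: "u \<in> V" "E i0 u" "E j0 u" "x u = 0" using common by blast
    have adj: "E h u" if h: "h \<in> H" for h
    proof -
      obtain u' where u': "u' \<in> V" "E h u'" "E j0 u'" "x u' = 0" using common[OF h] by blast
      have "u' = u" using down[OF j0, of u] u u' \<open>b < 0\<close> by auto
      then show ?thesis using u' by simp
    qed
    show False
    proof (rule spectral_bound_no_cut[OF \<open>spectral_bound\<close>, of H u])
      show "H \<subseteq> V" "H \<noteq> {}" "u \<in> V" "u \<notin> H"
        using \<open>i0 \<in> H\<close> u \<open>0 < a\<close> by (auto simp: H_def)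
      fix h assume h: "h \<in> H"
      show "E h u" by (rule adj[OF h])
      fix w assume "w \<in> V" "E h w"
      then show "w = u \<or> w \<in> H" using up[of h u] h adj[OF h] u by (auto simp: H_def)
    qed
  qed
  then obtain i j where ij: "i \<in> V" "j \<in> V" "x i = a" "x j = b" "\<And>v. v \<in> V \<Longrightarrow> \<not> (E i v \<and> E j v)"
    by blast
  moreover have "\<not> E i j" using up[of i j] ij \<open>b < 0\<close> by auto
  ultimately show thesis using that[of i j] a b \<open>0 < a\<close> \<open>b < 0\<close> by auto
qed

end

context fin_graph
begin

lemma no_eigenvectors:
  fixes x z :: "'a \<Rightarrow> real"
  assumes spectral_bound and n: "2 \<le> card V" and tr: "2 * (\<Sum>v\<in>V. card (nb v)) = card V * (card V - 1)"
    and x: "\<And>v. v \<in> V \<Longrightarrow> lap x v = x v" "\<exists>v\<in>V. x v \<noteq> 0"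
    and z: "\<And>v. v \<in> V \<Longrightarrow> colap z v = z v" "\<exists>v\<in>V. z v \<noteq> 0"
  shows False
proof -
  interpret gx: eigen_graph V E x using x by unfold_locales
  interpret gz: eigen_graph V "compl_rel E" z using z compl_graph by (simp add: eigen_graph_def eigen_graph_axioms_def)
  obtain i j where iV: "i \<in> V" and jV: "j \<in> V" and x_le: "\<And>v. v \<in> V \<Longrightarrow> x v \<le> x i"
    and x_ge: "\<And>v. v \<in> V \<Longrightarrow> x j \<le> x v" and x_pos: "0 < x i" "x j < 0"
    and ij: "\<not> E i j" and disj: "\<And>v. v \<in> V \<Longrightarrow> \<not> (E i v \<and> E j v)"
    using gx.far_pair[OF \<open>spectral_bound\<close> x(2)] by blast
  obtain k l where kV: "k \<in> V" and lV: "l \<in> V" and z_le: "\<And>v. v \<in> V \<Longrightarrow> z v \<le> z k"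
    and z_ge: "\<And>v. v \<in> V \<Longrightarrow> z l \<le> z v" and z_pos: "0 < z k" "z l < 0"
    and kl0: "\<not> compl_rel E k l" and dom0: "\<And>v. v \<in> V \<Longrightarrow> \<not> (compl_rel E k v \<and> compl_rel E l v)"
    using gz.far_pair[OF spectral_bound_compl[OF \<open>spectral_bound\<close>] z(2)] by blast
  have kl: "E k l" using kl0 z_pos by (auto simp: compl_rel_def)
  have dom: "E v k \<or> E v l" if "v \<in> V" "v \<noteq> k" "v \<noteq> l" for v
    using dom0[OF that(1)] that sym by (auto simp: compl_rel_def)
  have ne: "i \<noteq> j" "k \<noteq> l" using x_pos z_pos by auto
  have deg: "2 \<le> card (nb v)" if "v \<in> V" for v by (rule spectral_bound_degree[OF \<open>spectral_bound\<close> n that])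
  have codeg: "2 \<le> card (conb v)" if "v \<in> V" for v
    by (rule fin_graph.spectral_bound_degree[OF compl_graph spectral_bound_compl[OF \<open>spectral_bound\<close>] n that])
  \<comment> \<open>If \<open>i\<close> or \<open>j\<close> were one end of a dominating edge, the
    other of the two would have to be adjacent to the far end, which would then be a common
    neighbour of \<open>i\<close> and \<open>j\<close>.\<close>
  have meet: False if ab: "E a b" and a: "a \<in> {i, j}" and bV: "b \<in> V" and dom_ab: "\<And>v. v \<in> V \<Longrightarrow> v \<noteq> a \<Longrightarrow> v \<noteq> b \<Longrightarrow> E v a \<or> E v b" for a b
  proof -
    obtain c where c: "c \<in> {i, j}" "c \<noteq> a" "\<not> E a c" "c \<in> V" "\<And>v. v \<in> V \<Longrightarrow> \<not> (E a v \<and> E c v)"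
    proof (cases "a = i")
      case True
      show thesis by (rule that[of j]) (use True ne ij jV disj in blast)+
    next
      case False
      then have "a = j" using a by blast
      show thesis by (rule that[of i]) (use \<open>a = j\<close> ne ij sym iV disj in blast)+
    qed
    then have "E c b" using ab dom_ab[of c] sym[of c a] by blast
    then show False using c(5)[OF bV] ab by blast
  qed
  have "k \<notin> {i, j}" using meet[OF kl _ lV] dom by blast
  moreover have "l \<notin> {i, j}" using meet[OF sym[OF kl] _ kV] dom by blast
  ultimately have "i \<noteq> k" "i \<noteq> l" "j \<noteq> k" "j \<noteq> l" by blast+
  have neg: "colap (\<lambda>v. - z v) v = - colap z v" for v
    by (simp add: lapl_def sum_negf[symmetric])
  \<comment> \<open>Of \<open>k\<close> and \<open>l\<close>, the vertex \<open>i\<close> is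
    adjacent to exactly one and \<open>j\<close> to the other. If \<open>i\<close> is adjacent to
    \<open>k\<close>, replacing \<open>z\<close> by its negative exchanges their roles.\<close>
  have "\<exists>z k l. extremal_config V E x z i j k l"
  proof (cases "E i l")
    case True
    then have "\<not> E j l" using disj[OF lV] by blast
    then have "E j k" using dom[OF jV] \<open>j \<noteq> k\<close> \<open>j \<noteq> l\<close> by blast
    then have "\<not> E i k" using disj[OF kV] by blast
    have "extremal_config V E x z i j k l"
      by unfold_locales (fact x(1) z(1) iV jV kV lV x_le x_ge z_le z_ge x_pos z_pos True sym[OF \<open>E j k\<close>] kl
        \<open>\<not> E i k\<close> \<open>\<not> E j l\<close> ij \<open>i \<noteq> k\<close> \<open>j \<noteq> l\<close> ne disj dom deg codeg)+
    then show ?thesis by blast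
  next
    case False
    then have "E i k" using dom[OF iV] \<open>i \<noteq> k\<close> \<open>i \<noteq> l\<close> by blast
    then have "\<not> E j k" using disj[OF kV] by blast
    then have "E j l" using dom[OF jV] \<open>j \<noteq> k\<close> \<open>j \<noteq> l\<close> by blast
    have zn: "colap (\<lambda>v. - z v) v = - z v" "- z v \<le> - z l" "- z k \<le> - z v" if "v \<in> V" for v
      using neg z(1) z_le z_ge that by auto
    have zs: "0 < - z l" "- z k < 0" using z_pos by auto
    have dom': "E v l \<or> E v k" if "v \<in> V" "v \<noteq> l" "v \<noteq> k" for v using dom that by blast
    have "extremal_config V E x (\<lambda>v. - z v) i j l k"
      by unfold_locales (fact x(1) zn iV jV kV lV x_le x_ge x_pos zs \<open>E i k\<close> sym[OF \<open>E j l\<close>] sym[OF kl] False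
        \<open>\<not> E j k\<close> ij \<open>i \<noteq> l\<close> \<open>j \<noteq> k\<close> ne disj dom' deg codeg)+
    then show ?thesis by blast
  qed
  then obtain z k l where "extremal_config V E x z i j k l" by blast
  then have "card V < 8" by (rule extremal_config.card_less)
  moreover have "6 \<le> card V"
  proof -
    have "card (nb i \<union> nb j) = card (nb i) + card (nb j)"
      using disj by (intro card_Un_disjoint) auto
    moreover have "card (insert i (insert j (nb i \<union> nb j))) = 2 + card (nb i \<union> nb j)"
      using ij irr ne sym by (auto simp: card_insert_if)
    moreover have "card (insert i (insert j (nb i \<union> nb j))) \<le> card V"
      using iV jV finV by (intro card_mono) auto
    ultimately show ?thesis using deg[OF iV] deg[OF jV] by linarith
  qed
  ultimately have "card V = 6 \<or> card V = 7" by linarith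
  then have "(\<Sum>v\<in>V. card (nb v)) = 15 \<or> (\<Sum>v\<in>V. card (nb v)) = 21" using tr by auto
  then show False using even_sum_degree by auto
qed

section \<open>Integral spectra\<close>

lemma lap_symmetric: "(\<Sum>v\<in>V. f v * lap g v) = (\<Sum>v\<in>V. lap f v * g v)"
proof -
  have expand: "lap h v = (\<Sum>w\<in>V. of_bool (E v w) * (h v - h w))" for h v
  proof -
    have "lap h v = (\<Sum>w\<in>V. if E v w then h v - h w else 0)"
      unfolding lapl_def nbs_def by (rule sum.inter_filter[OF finV])
    also have "\<dots> = (\<Sum>w\<in>V. of_bool (E v w) * (h v - h w))"
      by (intro sum.cong refl) simp
    finally show ?thesis .
  qed
  have "(\<Sum>v\<in>V. f v * lap g v - lap f v * g v)
      = (\<Sum>v\<in>V. \<Sum>w\<in>V. of_bool (E v w) * f w * g v) - (\<Sum>v\<in>V. \<Sum>w\<in>V. of_bool (E v w) * f v * g w)"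
    by (simp add: expand sum_distrib_left sum_distrib_right flip: sum_subtractf)
       (simp add: algebra_simps)
  also have "(\<Sum>v\<in>V. \<Sum>w\<in>V. of_bool (E v w) * f w * g v) = (\<Sum>v\<in>V. \<Sum>w\<in>V. of_bool (E w v) * f v * g w)"
    by (rule sum.swap)
  also have "\<dots> = (\<Sum>v\<in>V. \<Sum>w\<in>V. of_bool (E v w) * f v * g w)"
  proof (intro sum.cong refl)
    show "of_bool (E w v) * f v * g w = of_bool (E v w) * f v * g w" for v w
      using sym[of v w] sym[of w v] by (cases "E v w") auto
  qed
  finally show ?thesis by (simp add: sum_subtractf)
qed

text \<open>Eigenfunctions for different eigenvalues of a symmetric operator are orthogonal.
  Normalised, they are the rows of a square matrix with orthonormal rows; its columns are then
  orthonormal too, which is the completeness relation.\<close>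

lemma eigenbasis:
  assumes ev: "\<And>k. k < card V \<Longrightarrow> \<exists>f. (\<exists>v\<in>V. f v \<noteq> 0) \<and> (\<forall>v\<in>V. lap f v = real k * f v)"
  obtains \<phi> :: "nat \<Rightarrow> 'a \<Rightarrow> real" where
    "\<And>k v. k < card V \<Longrightarrow> v \<in> V \<Longrightarrow> lap (\<phi> k) v = real k * \<phi> k v"
    "\<And>k m. k < card V \<Longrightarrow> m < card V \<Longrightarrow> (\<Sum>v\<in>V. \<phi> k v * \<phi> m v) = of_bool (k = m)"
    "\<And>u v. u \<in> V \<Longrightarrow> v \<in> V \<Longrightarrow> (\<Sum>k<card V. \<phi> k u * \<phi> k v) = of_bool (u = v)"
proof -
  define n where "n = card V"
  obtain f where f: "\<And>k. k < n \<Longrightarrow> \<exists>v\<in>V. f k v \<noteq> 0"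
    "\<And>k v. k < n \<Longrightarrow> v \<in> V \<Longrightarrow> lap (f k) v = real k * f k v"
    using ev unfolding n_def by metis
  define N where "N k = (\<Sum>v\<in>V. (f k v)\<^sup>2)" for k
  have N: "0 < N k" if k: "k < n" for k
  proof -
    obtain v where "v \<in> V" "f k v \<noteq> 0" using f(1)[OF k] by blast
    then show ?thesis unfolding N_def using finV by (intro sum_pos2[of _ v]) auto
  qed
  define \<phi> where "\<phi> k v = f k v / sqrt (N k)" for k v
  have lap: "lap (\<phi> k) v = real k * \<phi> k v" if "k < n" "v \<in> V" for k v
  proof -
    have "lap (\<phi> k) v = lap (f k) v / sqrt (N k)"
      by (simp add: lapl_def \<phi>_def sum_divide_distrib diff_divide_distrib)
    then show ?thesis using f(2)[OF that] by (simp add: \<phi>_def)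
  qed
  have orth: "(\<Sum>v\<in>V. \<phi> k v * \<phi> m v) = of_bool (k = m)" if km: "k < n" "m < n" for k m
  proof (cases "k = m")
    case True
    have "(\<Sum>v\<in>V. \<phi> k v * \<phi> k v) = (\<Sum>v\<in>V. (f k v)\<^sup>2 / N k)"
      using N[OF km(1)] by (intro sum.cong refl) (simp add: \<phi>_def power2_eq_square real_sqrt_mult_self)
    also have "\<dots> = 1" using N[OF km(1)] by (simp add: N_def flip: sum_divide_distrib)
    finally show ?thesis using True by simp
  next
    case False
    have "real m * (\<Sum>v\<in>V. \<phi> k v * \<phi> m v) = (\<Sum>v\<in>V. \<phi> k v * lap (\<phi> m) v)"
      using lap[OF km(2)] by (simp add: sum_distrib_left mult_ac)
    also have "\<dots> = (\<Sum>v\<in>V. lap (\<phi> k) v * \<phi> m v)" by (rule lap_symmetric)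
    also have "\<dots> = real k * (\<Sum>v\<in>V. \<phi> k v * \<phi> m v)"
      using lap[OF km(1)] by (simp add: sum_distrib_left mult_ac)
    finally show ?thesis using False by simp
  qed
  obtain vs where vs: "set vs = V" "distinct vs"
    using finite_distinct_list[OF finV] by blast
  have len: "length vs = n" using distinct_card[OF vs(2)] vs(1) by (simp add: n_def)
  have bij: "bij_betw ((!) vs) {0..<n} V"
    using bij_betw_nth[OF vs(2), of "{0..<n}" V] vs(1) len by (auto simp: atLeast0LessThan)
  define A where "A = mat n n (\<lambda>(k, a). \<phi> k (vs ! a))"
  define A' where "A' = mat n n (\<lambda>(a, k). \<phi> k (vs ! a))"
  have A: "A \<in> carrier_mat n n" "A' \<in> carrier_mat n n" by (simp_all add: A_def A'_def)
  have "A * A' = 1\<^sub>m n"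
  proof (rule eq_matI)
    fix k m assume "k < dim_row (1\<^sub>m n :: real mat)" "m < dim_col (1\<^sub>m n :: real mat)"
    then have km: "k < n" "m < n" by auto
    have "(A * A') $$ (k, m) = (\<Sum>a = 0..<n. \<phi> k (vs ! a) * \<phi> m (vs ! a))"
      using km by (simp add: A_def A'_def scalar_prod_def)
    also have "\<dots> = (\<Sum>v\<in>V. \<phi> k v * \<phi> m v)" by (rule sum.reindex_bij_betw[OF bij])
    finally show "(A * A') $$ (k, m) = (1\<^sub>m n :: real mat) $$ (k, m)" using orth[OF km] km by simp
  qed (use A in auto)
  then have "A' * A = 1\<^sub>m n" by (rule mat_mult_left_right_inverse[OF A])
  have "(\<Sum>k<n. \<phi> k u * \<phi> k v) = of_bool (u = v)" if uv: "u \<in> V" "v \<in> V" for u v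
  proof -
    obtain a b where ab: "a < n" "b < n" "u = vs ! a" "v = vs ! b"
      using uv vs len by (metis in_set_conv_nth)
    have "(\<Sum>k<n. \<phi> k u * \<phi> k v) = (A' * A) $$ (a, b)"
      using ab by (simp add: A_def A'_def scalar_prod_def atLeast0LessThan)
    also have "\<dots> = of_bool (a = b)" using \<open>A' * A = 1\<^sub>m n\<close> ab by simp
    also have "a = b \<longleftrightarrow> u = v" using ab vs(2) len by (simp add: nth_eq_iff_index_eq)
    finally show ?thesis .
  qed
  then show thesis using that[of \<phi>] lap orth unfolding n_def by blast
qed

lemma integral_spectrum:
  assumes ne: "V \<noteq> {}"
    and ev: "\<And>k. k < card V \<Longrightarrow> \<exists>f. (\<exists>v\<in>V. f v \<noteq> 0) \<and> (\<forall>v\<in>V. lap f v = real k * f v)"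
  shows spectral_bound and "(\<Sum>v\<in>V. card (nb v)) = (\<Sum>k<card V. k)"
proof -
  define n where "n = card V"
  obtain \<phi> where lap: "\<And>k v. k < n \<Longrightarrow> v \<in> V \<Longrightarrow> lap (\<phi> k) v = real k * \<phi> k v"
    and orth: "\<And>k m. k < n \<Longrightarrow> m < n \<Longrightarrow> (\<Sum>v\<in>V. \<phi> k v * \<phi> m v) = of_bool (k = m)"
    and complete: "\<And>u v. u \<in> V \<Longrightarrow> v \<in> V \<Longrightarrow> (\<Sum>k<n. \<phi> k u * \<phi> k v) = of_bool (u = v)"
    using eigenbasis[OF ev] unfolding n_def by blast
  have n: "0 < n" using ne finV by (simp add: n_def card_gt_0_iff)
  define c where "c f k = (\<Sum>v\<in>V. f v * \<phi> k v)" for f k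
  have parseval: "(\<Sum>v\<in>V. f v * g v) = (\<Sum>k<n. c f k * c g k)" for f g
  proof -
    have "(\<Sum>k<n. c f k * c g k) = (\<Sum>k<n. \<Sum>u\<in>V. \<Sum>v\<in>V. f u * g v * (\<phi> k u * \<phi> k v))"
      unfolding c_def sum_product by (intro sum.cong refl) (simp add: mult_ac)
    also have "\<dots> = (\<Sum>u\<in>V. \<Sum>v\<in>V. f u * g v * (\<Sum>k<n. \<phi> k u * \<phi> k v))"
      unfolding sum_distrib_left by (subst sum.swap, intro sum.cong refl, subst sum.swap) simp
    also have "\<dots> = (\<Sum>u\<in>V. \<Sum>v\<in>V. if v = u then f u * g u else 0)"
      using complete by (intro sum.cong refl) auto
    also have "\<dots> = (\<Sum>u\<in>V. f u * g u)" using finV by simp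
    finally show ?thesis by simp
  qed
  have c_lap: "c (lap f) k = real k * c f k" if k: "k < n" for f k
  proof -
    have "c (lap f) k = (\<Sum>v\<in>V. f v * lap (\<phi> k) v)" unfolding c_def by (rule lap_symmetric[symmetric])
    also have "\<dots> = real k * c f k"
      unfolding c_def sum_distrib_left using lap[OF k] by (intro sum.cong refl) simp
    finally show ?thesis .
  qed
  \<comment> \<open>Constants lie in the kernel of the Laplacian, so only the coefficient with index
    0 sees them; removing the mean of \<open>y\<close> means removing \<open>c y 0\<close>.\<close>
  have c_one: "c (\<lambda>_. 1) k = 0" if "k < n" "k \<noteq> 0" for k
    using c_lap[OF that(1), of "\<lambda>_. 1"] that(2) by (simp add: lapl_def c_def)
  have shift: "(\<Sum>k<n. h k) = h 0 + (\<Sum>k\<in>{1..<n}. h k)" for h :: "nat \<Rightarrow> real"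
    using n by (simp add: sum.atLeast_Suc_lessThan flip: atLeast0LessThan)
  have c0: "(c (\<lambda>_. 1) 0)\<^sup>2 = n"
    using parseval[of "\<lambda>_. 1" "\<lambda>_. 1"] shift[of "\<lambda>k. c (\<lambda>_. 1) k * c (\<lambda>_. 1) k"] c_one
    by (simp add: n_def power2_eq_square)
  show spectral_bound
    unfolding spectral_bound_def
  proof
    fix y
    have "(\<Sum>v\<in>V. y v) = c y 0 * c (\<lambda>_. 1) 0"
      using parseval[of y "\<lambda>_. 1"] shift[of "\<lambda>k. c y k * c (\<lambda>_. 1) k"] c_one by simp
    then have mean: "(\<Sum>v\<in>V. y v)\<^sup>2 / n = (c y 0)\<^sup>2" using c0 n by (simp add: power_mult_distrib)
    have sq: "(\<Sum>v\<in>V. (y v)\<^sup>2) - (c y 0)\<^sup>2 = (\<Sum>k\<in>{1..<n}. (c y k)\<^sup>2)"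
      using parseval[of y y] shift[of "\<lambda>k. c y k * c y k"] by (simp add: power2_eq_square)
    have c_co: "c (colap y) k = (real n - real k) * c y k" if "k < n" "k \<noteq> 0" for k
    proof -
      have "colap y v = real n * y v - (\<Sum>w\<in>V. y w) - lap y v" if "v \<in> V" for v
        using lap_co[OF that, of y] unfolding n_def by linarith
      then have "c (colap y) k = (\<Sum>v\<in>V. (real n * y v - (\<Sum>w\<in>V. y w) - lap y v) * \<phi> k v)"
        unfolding c_def by (intro sum.cong refl) simp
      also have "\<dots> = real n * c y k - (\<Sum>w\<in>V. y w) * c (\<lambda>_. 1) k - c (lap y) k"
        by (simp add: c_def left_diff_distrib sum_subtractf sum_distrib_left mult.assoc)
      finally show ?thesis using c_lap[OF that(1), of y] c_one[OF that] by (simp add: algebra_simps)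
    qed
    have "(\<Sum>v\<in>V. lap y v * colap y v) = (\<Sum>k\<in>{1..<n}. real k * (real n - real k) * (c y k)\<^sup>2)"
      unfolding parseval shift using c_lap[of 0 y] n
      by (simp add: c_lap c_co power2_eq_square mult_ac)
    moreover have "(\<Sum>k\<in>{1..<n}. (real n - 1) * (c y k)\<^sup>2) \<le> \<dots>"
    proof (intro sum_mono mult_right_mono)
      \<comment> \<open>In the eigenbasis the product of the two Laplacians has the values
        \<open>k * (n - k)\<close>, and \<open>k * (n - k) - (n - 1)\<close> factors as
        below.\<close>
      fix k assume k: "k \<in> {1..<n}"
      have "0 \<le> (real k - 1) * (real n - 1 - real k)" using k by (intro mult_nonneg_nonneg) auto
      then show "real n - 1 \<le> real k * (real n - real k)" by (simp add: algebra_simps)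
    qed simp
    ultimately show "(real (card V) - 1) * ((\<Sum>v\<in>V. (y v)\<^sup>2) - (\<Sum>v\<in>V. y v)\<^sup>2 / card V)
        \<le> (\<Sum>v\<in>V. lap y v * colap y v)"
      using mean sq by (simp add: n_def sum_distrib_left)
  qed
  \<comment> \<open>The degree is a diagonal entry of the Laplacian, expanded in the eigenbasis;
    summing over \<open>u\<close> computes the trace.\<close>
  have deg: "real (card (nb u)) = (\<Sum>k<n. real k * (\<phi> k u * \<phi> k u))" if u: "u \<in> V" for u
  proof -
    define e :: "'a \<Rightarrow> real" where "e = (\<lambda>w. of_bool (w \<in> {u}))"
    have ce: "c e k = \<phi> k u" for k
      using u finV by (simp add: c_def e_def of_bool_def if_distrib[of "\<lambda>t. t * _"] cong: if_cong)
    have "(\<Sum>v\<in>V. lap e v * e v) = lap e u"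
      using u finV by (simp add: e_def of_bool_def if_distrib[of "\<lambda>t. _ * t"] cong: if_cong)
    moreover have "nb u - {u} = nb u" using irr by auto
    then have "lap e u = card (nb u)" using lap_ind[of "{u}" u] by (simp add: e_def)
    ultimately show ?thesis using parseval[of "lap e" e] c_lap[of _ e] by (simp add: ce mult_ac)
  qed
  have "real (\<Sum>v\<in>V. card (nb v)) = (\<Sum>u\<in>V. \<Sum>k<n. real k * (\<phi> k u * \<phi> k u))"
    using deg by simp
  also have "\<dots> = (\<Sum>k<n. real k * (\<Sum>u\<in>V. \<phi> k u * \<phi> k u))"
    unfolding sum_distrib_left by (rule sum.swap)
  also have "\<dots> = real (\<Sum>k<n. k)" using orth by simp
  finally show "(\<Sum>v\<in>V. card (nb v)) = (\<Sum>k<card V. k)" unfolding n_def by (simp only: of_nat_eq_iff)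
qed

lemma no_integral_spectrum:
  assumes n: "2 \<le> card V"
    and ev: "\<And>k. k < card V \<Longrightarrow> \<exists>f. (\<exists>v\<in>V. f v \<noteq> 0) \<and> (\<forall>v\<in>V. lap f v = real k * f v)"
  shows False
proof -
  have ne: "V \<noteq> {}" using n by auto
  obtain x where x: "\<exists>v\<in>V. x v \<noteq> 0" "\<And>v. v \<in> V \<Longrightarrow> lap x v = x v"
    using ev[of 1] n by auto
  obtain z where z: "\<exists>v\<in>V. z v \<noteq> 0" "\<And>v. v \<in> V \<Longrightarrow> lap z v = (real (card V) - 1) * z v"
    using ev[of "card V - 1"] n by (auto simp: of_nat_diff)
  \<comment> \<open>Being an eigenfunction for \<open>n - 1 > 0\<close>, \<open>z\<close> has mean
    zero, so its eigenvalue in the complement is \<open>n - (n - 1) = 1\<close>.\<close>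
  have "(\<Sum>v\<in>V. (real (card V) - 1) * z v) = 0" using sum_lap[of z] z(2) by simp
  then have "(\<Sum>v\<in>V. z v) = 0" using n by (simp flip: sum_distrib_left)
  then have "colap z v = z v" if "v \<in> V" for v
    using lap_co[OF that, of z] z(2)[OF that] by (simp add: algebra_simps)
  moreover have "2 * (\<Sum>v\<in>V. card (nb v)) = card V * (card V - 1)"
  proof -
    have "2 * (\<Sum>k<m. k) = m * (m - 1)" for m :: nat by (induction m) (auto simp: algebra_simps diff_mult_distrib2)
    then show ?thesis using integral_spectrum(2)[OF ne ev] by simp
  qed
  ultimately show False
    using no_eigenvectors[OF integral_spectrum(1)[OF ne ev] n _ x(2,1) _ z(1)] by blast
qed

end

section \<open>From the spectrum of the matrix to eigenfunctions on the vertices\<close>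

theorem theorem4p20:
  fixes n :: nat
  assumes "n \<ge> 2"
  shows "\<not> (\<exists>G :: 'a pair_pre_digraph. pair_graph G \<and> card (pverts G) = n \<and>
            laplacian_spectrum G = image_mset real (mset_set {0..n - 1}))"
proof
  assume "\<exists>G :: 'a pair_pre_digraph. pair_graph G \<and> card (pverts G) = n \<and>
            laplacian_spectrum G = image_mset real (mset_set {0..n - 1})"
  then obtain G :: "'a pair_pre_digraph" where "pair_graph G" and card: "card (pverts G) = n"
    and spec: "laplacian_spectrum G = image_mset real (mset_set {0..n - 1})" by blast
  interpret G: pair_graph G by fact
  define V where "V = pverts G"
  define E where "E u v \<longleftrightarrow> (u, v) \<in> parcs G" for u v
  have finV: "finite V" using G.pair_finite_verts by (simp add: V_def)
  interpret fin_graph V E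
  proof
    show "finite V" by (rule finV)
    show "E v u" if "E u v" for u v
      using that G.pair_sym_arcs unfolding E_def symmetric_def by (simp add: sym_def)
    show "\<not> E v v" for v using G.pair_no_loops[of "(v, v)"] by (auto simp: E_def)
  qed
  obtain vs where vs: "set vs = V" "distinct vs"
    using finite_distinct_list[OF finV] by blast
  have len: "length vs = n" using distinct_card[OF vs(2)] vs(1) card by (simp add: V_def)
  define L where "L = laplacian_mat G vs"
  have L: "L \<in> carrier_mat n n" by (simp add: L_def laplacian_mat_def len)
  have proots: "proots (char_poly L) = image_mset real (mset_set {0..n - 1})"
    using laplacian_spectrum_eq[OF vs(2)] vs(1) spec by (simp add: L_def V_def)
  have degree: "out_degree (with_proj G) v = card (nb v)" for v
  proof -
    have "w \<in> V" if "(v, w) \<in> parcs G" for w using G.in_arcsD2[OF that] by (simp add: V_def)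
    then have "out_arcs (with_proj G) v = Pair v ` nb v"
      by (auto simp: out_arcs_def E_def)
    then show ?thesis by (simp add: out_degree_def card_image inj_on_def)
  qed
  have lap: "(\<Sum>w\<in>V. laplacian G v w * f w) = lap f v" if v: "v \<in> V" for v and f :: "'a \<Rightarrow> real"
  proof -
    have "(\<Sum>w\<in>V. laplacian G v w * f w)
        = (\<Sum>w\<in>V. (if w = v then card (nb v) * f v else 0) - (if E v w then f w else 0))"
      using irr by (intro sum.cong refl) (auto simp: laplacian_def degree E_def)
    also have "\<dots> = card (nb v) * f v - (\<Sum>w\<in>nb v. f w)"
      using v finV by (simp add: sum_subtractf nbs_def flip: sum.inter_filter)
    finally show ?thesis by (simp add: lapl_def sum_subtractf)
  qed
  have bij: "bij_betw ((!) vs) {0..<n} V"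
    using bij_betw_nth[OF vs(2), of "{0..<n}" V] vs(1) len by (auto simp: atLeast0LessThan)
  show False
  proof (rule no_integral_spectrum)
    show "2 \<le> card V" using assms card by (simp add: V_def)
    fix k assume "k < card V"
    \<comment> \<open>As \<open>n\<close> is positive, the truncated subtraction in
      \<open>{0..n - 1}\<close> is harmless and the set consists of all
      \<open>k < n\<close>.\<close>
    then have "real k \<in># proots (char_poly L)" using card finV assms by (auto simp: V_def proots)
    then have "poly (char_poly L) (real k) = 0"
      by (cases "char_poly L = 0") auto
    then obtain y where "eigenvector L y (real k)"
      using eigenvalue_root_char_poly[OF L] by (auto simp: eigenvalue_def)
    then have y: "y \<in> carrier_vec n" "y \<noteq> 0\<^sub>v n" "L *\<^sub>v y = real k \<cdot>\<^sub>v y"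
      using L by (auto simp: eigenvector_def)
    define f where "f v = y $ inv_into {0..<n} ((!) vs) v" for v
    have f: "f (vs ! a) = y $ a" if "a < n" for a
      using bij_betw_inv_into_left[OF bij, of a] that by (simp add: f_def)
    have "lap f (vs ! a) = real k * f (vs ! a)" if a: "a < n" for a
    proof -
      have "(L *\<^sub>v y) $ a = (\<Sum>b = 0..<n. laplacian G (vs ! a) (vs ! b) * f (vs ! b))"
        using a y(1) f by (simp add: L_def laplacian_mat_def len scalar_prod_def)
      also have "\<dots> = (\<Sum>w\<in>V. laplacian G (vs ! a) w * f w)" by (rule sum.reindex_bij_betw[OF bij])
      also have "\<dots> = lap f (vs ! a)" using a vs len by (intro lap) auto
      finally show ?thesis using y a f by simp
    qed
    then have "\<forall>v\<in>V. lap f v = real k * f v" using bij by (force simp: bij_betw_def)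
    moreover have "\<exists>v\<in>V. f v \<noteq> 0"
    proof (rule ccontr)
      assume "\<not> (\<exists>v\<in>V. f v \<noteq> 0)"
      then have "y $ a = 0" if "a < n" for a using f[OF that] that bij by (force simp: bij_betw_def)
      then show False using y(1,2) by (auto intro: eq_vecI)
    qed
    ultimately show "\<exists>f. (\<exists>v\<in>V. f v \<noteq> 0) \<and> (\<forall>v\<in>V. lap f v = real k * f v)" by blast
  qed
qed

end
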